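(* For every $\kappa>0$ the infimum $E_\kappa$ (defined in the context) is achieved. In addition: (a) $E_\kappa=\frac{\pi}{2}$ for $\kappa\ge 1$, and it is only achieved by the zero function. (b) $E_\kappa$ is achieved by $U_\kappa$ whenever $\kappa\in(0,1)$. (c) If $0<\kappa_1<\kappa_2\le 1$, then $E_{\kappa_1}<E_{\kappa_2}$. (d) There are universal positive constants $C$ and $d$ such that for $0<\kappa<1$ the odd zero-up ground state $U_\kappa$ satisfies $$\left|U_\kappa(x)-\tanh\left(\frac{x}{\sqrt2\,\kappa}\right)\right|\le C\exp\left(-\frac{d}{\kappa}\right),\qquad 0\le x\le\frac{\pi}{2},$$ and $$\lim_{\kappa\to0}\frac{E_\kappa}{\kappa}=\frac43\sqrt2>0.$$ (e) For $0<\kappa<1$, any $2\pi$-periodic solution $u$ of $\kappa^2u''+u-u^3=0$ on $\mathbb{R}$ which is not identically $1$, $-1$ or $0$ must coincide (after some shift and odd reflection if necessary) with $\tilde u_{\kappa,j}$ for some integer $1\le j<1/\kappa$, where $\tilde u_{\kappa,j}(x)=U_{j\kappa}(jx)$. Furthermore $E_\kappa(u)=E_{j\kappa}(U_{j\kappa})$.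
   Context: Let $\mathbb{T}=[-\pi,\pi]$ be the periodic torus. For $\kappa>0$ and $2\pi$-periodic $u\in H^1(\mathbb{T})$ define the energy functional $$E_\kappa(u)=\int_{\mathbb{T}}\left(\frac{\kappa^2}{2}|\partial_xu|^2+\frac14(1-u^2)^2\right)dx.$$ The number $E_\kappa$ (without argument) is $$E_\kappa=\inf_{u\in\mathcal S}E_\kappa(u),$$ where $\mathcal S$ is the set of $\phi\in H^1(\mathbb T)$ with $\phi(x+2\pi)=\phi(x)$, $|\phi(x)|<1$ for all $x\in\mathbb R$, solving $\kappa^2\phi''+\phi-\phi^3=0$ on $\mathbb{R}$. For $0<\kappa<1$, let $N_\kappa\in(0,1)$ be the unique number with $\int_0^{\pi/2}\frac{d\theta}{\sqrt{2-N_\kappa^2(1+\sin^2\theta)}}=\frac{\pi}{2\sqrt2\,\kappa}$. The odd zero-up ground state $U_\kappa:\mathbb R\to\mathbb R$ is the $2\pi$-periodic odd $C^\infty$ solution of $\kappa^2U_\kappa''+U_\kappa-U_\kappa^3=0$ with $U_\kappa(0)=U_\kappa'(\frac\pi2)=0$, $U_\kappa(\frac\pi2)=N_\kappa$, $U_\kappa$ monotonically increasing on $[0,\frac\pi2]$ and $U_\kappa(\pi-x)=U_\kappa(x)$ for $\frac\pi2\le x\le\pi$. Shift and odd reflection mean the operations $u(x)\mapsto u(x+a)$, $a\in\mathbb R$, and $u(x)\mapsto u(-x)$. *)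

theory Defs
  imports "HOL-Analysis.Analysis"
begin

definition torus :: "real set" where
  "torus = {-pi..pi}"

definition periodic_2pi :: "(real \<Rightarrow> real) \<Rightarrow> bool" where
  "periodic_2pi u \<longleftrightarrow> (\<forall>x. u (x + 2 * pi) = u x)"

definition smooth :: "(real \<Rightarrow> real) \<Rightarrow> bool" where
  "smooth u \<longleftrightarrow> (\<forall>n x. (deriv ^^ n) u field_differentiable at x)"

definition square_integrable_torus :: "(real \<Rightarrow> real) \<Rightarrow> bool" where
  "square_integrable_torus g \<longleftrightarrow>
     set_borel_measurable lebesgue torus g \<and> set_integrable lebesgue torus (\<lambda>x. (g x)\<^sup>2)"

definition weak_derivative_torus :: "(real \<Rightarrow> real) \<Rightarrow> (real \<Rightarrow> real) \<Rightarrow> bool" where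
  "weak_derivative_torus u g \<longleftrightarrow>
     (\<forall>\<psi>. smooth \<psi> \<and> periodic_2pi \<psi> \<longrightarrow>
        (LINT x:torus|lebesgue. u x * deriv \<psi> x) = - (LINT x:torus|lebesgue. g x * \<psi> x))"

(* A class in H^1 of the torus is represented by its unique continuous representative, so that
   pointwise conditions such as |u(x)| < 1 make sense. Square integrability of u itself is
   then automatic. *)
definition H1_torus :: "(real \<Rightarrow> real) set" where
  "H1_torus = {u. periodic_2pi u \<and> continuous_on UNIV u \<and>
     (\<exists>g. square_integrable_torus g \<and> weak_derivative_torus u g)}"

(* The continuous representative of an H^1 function is absolutely continuous, hence differentiable
   almost everywhere, and its pointwise derivative agrees almost everywhere with the weak one. *)
definition energy :: "real \<Rightarrow> (real \<Rightarrow> real) \<Rightarrow> real" where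
  "energy \<kappa> u =
     (LINT x:torus|lebesgue. \<kappa>\<^sup>2 / 2 * \<bar>deriv u x\<bar>\<^sup>2 + 1 / 4 * (1 - (u x)\<^sup>2)\<^sup>2)"

definition allen_cahn_solution :: "real \<Rightarrow> (real \<Rightarrow> real) \<Rightarrow> bool" where
  "allen_cahn_solution \<kappa> u \<longleftrightarrow>
     (\<exists>u' u''. \<forall>x. (u has_real_derivative u' x) (at x) \<and>
                   (u' has_real_derivative u'' x) (at x) \<and>
                   \<kappa>\<^sup>2 * u'' x + u x - (u x) ^ 3 = 0)"

definition solutions :: "real \<Rightarrow> (real \<Rightarrow> real) set" where
  "solutions \<kappa> = {\<phi> \<in> H1_torus. periodic_2pi \<phi> \<and> (\<forall>x. \<bar>\<phi> x\<bar> < 1) \<and> allen_cahn_solution \<kappa> \<phi>}"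

definition min_energy :: "real \<Rightarrow> real" where
  "min_energy \<kappa> = (INF \<phi>\<in>solutions \<kappa>. energy \<kappa> \<phi>)"

(* The definite descriptions below are meaningful for 0 < \<kappa> < 1. *)
definition ground_state_max :: "real \<Rightarrow> real" where
  "ground_state_max \<kappa> = (THE N. 0 < N \<and> N < 1 \<and>
     (LINT \<theta>:{0..pi/2}|lebesgue. 1 / sqrt (2 - N\<^sup>2 * (1 + (sin \<theta>)\<^sup>2))) = pi / (2 * sqrt 2 * \<kappa>))"

definition ground_state :: "real \<Rightarrow> real \<Rightarrow> real" where
  "ground_state \<kappa> = (THE U.
     periodic_2pi U \<and> (\<forall>x. U (- x) = - U x) \<and> smooth U \<and> allen_cahn_solution \<kappa> U \<and>
     U 0 = 0 \<and> deriv U (pi/2) = 0 \<and> U (pi/2) = ground_state_max \<kappa> \<and>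
     mono_on {0..pi/2} U \<and> (\<forall>x\<in>{pi/2..pi}. U (pi - x) = U x))"

definition rescaled_ground_state :: "real \<Rightarrow> nat \<Rightarrow> real \<Rightarrow> real" where
  "rescaled_ground_state \<kappa> j x = ground_state (real j * \<kappa>) (real j * x)"

(* The group generated by shifts u(x) \<mapsto> u(x + a) and the odd reflection u(x) \<mapsto> u(-x)
   consists of the maps u(x) \<mapsto> u(s x + a) with s = 1 or s = -1. *)
definition coincide_up_to_shift_reflection :: "(real \<Rightarrow> real) \<Rightarrow> (real \<Rightarrow> real) \<Rightarrow> bool" where
  "coincide_up_to_shift_reflection u v \<longleftrightarrow> (\<exists>a. \<exists>s\<in>{1, -1}. \<forall>x. u (s * x + a) = v x)"

end

theory Submission
  imports Defs "HOL-Real_Asymp.Real_Asymp"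
begin

text \<open>
In the time variable \<open>t = x / \<kappa>\<close> the equation becomes \<open>v'' = v\<^sup>3 - v\<close>, which conserves
\<open>2 v'\<^sup>2 - (1 - v\<^sup>2)\<^sup>2\<close>. On the level set of amplitude \<open>N < 1\<close>, that is
\<open>2 v'\<^sup>2 = (N\<^sup>2 - v\<^sup>2) (2 - N\<^sup>2 - v\<^sup>2)\<close>, the substitution \<open>v = N sin \<theta>\<close> removes the turning points:
the phase satisfies \<open>\<theta>' = phase_speed N \<theta>\<close> with a smooth positive right-hand side. So \<open>\<theta>\<close> is the
inverse of an elliptic integral (\<open>v\<close> is a rescaled Jacobi sn), and \<open>wave N\<close> is a solution on the
whole line whose symmetries, period and monotonicity can be read off. Its quarter period increases
strictly from \<open>\<pi> / 2\<close> at \<open>N = 0\<close> to infinity as \<open>N\<close> tends to 1, hence for \<open>0 < \<kappa> < 1\<close> exactly one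
amplitude has quarter period \<open>\<pi> / (2 \<kappa>)\<close>, and the rescaled wave with this amplitude is the ground
state (\<open>ground_state_eq\<close>).

Classification (\<open>periodic_solution_classification\<close>): at its maximum a periodic solution has zero
slope and a value \<open>M\<close> with \<open>M\<^sup>3 \<le> M\<close>, at its minimum the reversed inequality holds, so its values lie
in \<open>[-1, 1]\<close>. Uniqueness for the initial value problem at the maximum then identifies it with a
constant \<open>-1\<close>, \<open>0\<close>, \<open>1\<close> or with a shift of \<open>wave M\<close>, and \<open>2 \<pi>\<close>-periodicity forces the quarter period to
be \<open>\<pi> / (2 j \<kappa>)\<close> for some \<open>j \<ge> 1\<close>. Since quarter periods of nonconstant waves exceed \<open>\<pi> / 2\<close>, this
requires \<open>j \<kappa> < 1\<close>.

Energy: multiplying the equation by \<open>u\<close> and integrating by parts turns the energy of any periodic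
solution into one quarter of the integral of \<open>1 - u\<^sup>4\<close> (\<open>energy_of_solution\<close>). In this form it is
invariant under shifts and under \<open>u(x) \<mapsto> u(j x)\<close>, so the competitors of the ground state have energies
\<open>\<pi> / 2\<close> (zero) and those of the ground states with parameters \<open>j \<kappa>\<close>. It also decreases when \<open>\<bar>u\<bar>\<close>
increases, and ground states are pointwise ordered: at the same fraction of the quarter period the
wave of larger amplitude is the larger one (\<open>wave_less_at_same_fraction\<close>). Hence the ground state
energy strictly increases with \<open>\<kappa>\<close> and stays below \<open>\<pi> / 2\<close>, which gives minimality and monotonicity.

Small \<open>\<kappa>\<close>: with \<open>h(t) = tanh (t / sqrt 2)\<close>, for which \<open>h' = (1 - h\<^sup>2) / sqrt 2\<close>, the conservation law gives
\<open>0 \<le> h - wave N \<le> (1 - N\<^sup>2) t / sqrt 2\<close> up to the quarter period, and \<open>1 - N\<^sup>2\<close> is exponentially small in the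
quarter period because the elliptic integral diverges only logarithmically. Replacing the wave by
\<open>h\<close> in the integral of \<open>1 - u\<^sup>4\<close> leaves an explicit integral, from which the limit of the energy follows.
\<close>

section \<open>Calculus on the line\<close>

lemma primitive_exists:
  fixes f :: "real \<Rightarrow> real"
  assumes "continuous_on UNIV f"
  obtains F where "\<And>x. (F has_real_derivative f x) (at x)"
proof -
  have "isCont f x" for x
    using assms by (simp add: continuous_on_eq_continuous_at)
  then have "\<exists>F. \<forall>x::real. (-\<infinity>::ereal) < x \<longrightarrow> x < (\<infinity>::ereal) \<longrightarrow> (F has_vector_derivative f x) (at x)"
    by (intro einterval_antiderivative) auto
  then show ?thesis
    using that by (auto simp: has_real_derivative_iff_has_vector_derivative)
qed

lemma has_real_derivative_imp_continuous_on:
  fixes f :: "real \<Rightarrow> real"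
  assumes "\<And>x. (f has_real_derivative f' x) (at x)"
  shows "continuous_on A f"
  using assms by (meson DERIV_isCont continuous_at_imp_continuous_on)

lemma set_lebesgue_integral_FTC:
  fixes f :: "real \<Rightarrow> real"
  assumes "a \<le> b" and cont: "continuous_on {a..b} f"
    and F: "\<And>x. (F has_real_derivative f x) (at x)"
  shows "(LINT x:{a..b}|lebesgue. f x) = F b - F a"
proof -
  have "(f has_integral (F b - F a)) {a..b}"
    using \<open>a \<le> b\<close> F
    by (intro fundamental_theorem_of_calculus)
      (auto simp flip: has_real_derivative_iff_has_vector_derivative
        intro: has_field_derivative_at_within)
  then show ?thesis
    using set_lebesgue_integral_eq_integral(2)[OF absolutely_integrable_continuous_real[OF cont]]
    by (simp add: integral_unique)
qed

lemma derivative_shift_const: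
  fixes F :: "real \<Rightarrow> real"
  assumes F: "\<And>x. (F has_real_derivative f x) (at x)" and per: "\<And>x. f (x + p) = f x"
  shows "F (x + p) - F x = F (y + p) - F y"
proof -
  have "((\<lambda>x. F (x + p) - F x) has_real_derivative 0) (at x)" for x
    using F per by (auto intro!: derivative_eq_intros DERIV_chain2[OF F])
  then show ?thesis
    by (intro DERIV_isconst_all) auto
qed

lemma derivative_reflect_const:
  fixes F :: "real \<Rightarrow> real"
  assumes F: "\<And>x. (F has_real_derivative f x) (at x)" and refl: "\<And>x. f (c - x) = f x"
  shows "F x + F (c - x) = F y + F (c - y)"
proof -
  have "((\<lambda>x. F x + F (c - x)) has_real_derivative 0) (at x)" for x
    using F refl by (auto intro!: derivative_eq_intros DERIV_chain2[OF F])
  then show ?thesis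
    by (intro DERIV_isconst_all[where f = "\<lambda>x. F x + F (c - x)"]) auto
qed

text \<open>A negative value inside would, by the mean value theorem, produce a point with negative slope followed
by one with positive slope.\<close>

lemma above_chord_if_derivative_sign_changes:
  fixes f :: "real \<Rightarrow> real"
  assumes der: "\<And>x. (f has_real_derivative f' x) (at x)"
    and ends: "f a = 0" "f b = 0"
    and sign: "\<And>x y. a < x \<Longrightarrow> x < y \<Longrightarrow> y < b \<Longrightarrow> f' x < 0 \<Longrightarrow> f' y \<le> 0"
    and z: "a \<le> z" "z \<le> b"
  shows "0 \<le> f z"
proof (rule ccontr)
  assume "\<not> 0 \<le> f z"
  then have neg: "f z < 0" and "a < z" "z < b"
    using ends z by (auto simp: order_less_le not_le)
  obtain x where x: "a < x" "x < z" "f z - f a = (z - a) * f' x"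
    using MVT2[OF \<open>a < z\<close>, of f f'] der by blast
  obtain y where y: "z < y" "y < b" "f b - f z = (b - z) * f' y"
    using MVT2[OF \<open>z < b\<close>, of f f'] der by blast
  have "f' x < 0"
    using x neg ends \<open>a < z\<close> by (smt (verit) mult_nonneg_nonneg)
  moreover have "0 < f' y"
    using y neg ends \<open>z < b\<close> by (smt (verit) mult_nonneg_nonpos)
  ultimately show False
    using sign[of x y] x y by auto
qed

lemma cos_above_chord:
  assumes "0 \<le> x" "x \<le> pi / 2"
  shows "1 - 2 / pi * x \<le> cos x"
proof -
  have "0 \<le> cos x - (1 - 2 / pi * x)"
  proof (rule above_chord_if_derivative_sign_changes[where a = 0 and b = "pi / 2" and z = x
        and f = "\<lambda>x. cos x - (1 - 2 / pi * x)" and f' = "\<lambda>x. 2 / pi - sin x"])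
    show "((\<lambda>x. cos x - (1 - 2 / pi * x)) has_real_derivative 2 / pi - sin x) (at x)" for x
      by (auto intro!: derivative_eq_intros)
    show "2 / pi - sin y \<le> 0" if "0 < x" "x < y" "y < pi / 2" "2 / pi - sin x < 0" for x y :: real
      using that sin_monotone_2pi_le[of x y] by auto
  qed (use assms in auto)
  then show ?thesis by simp
qed

section \<open>The phase of the periodic waves\<close>

text \<open>The square of the phase speed is \<open>(2 - N\<^sup>2 - v\<^sup>2) / 2\<close> with \<open>v = N sin \<theta>\<close>: the factor of the conserved
quantity that does not vanish at the turning points \<open>v = \<plusminus>N\<close>.\<close>

definition phase_speed :: "real \<Rightarrow> real \<Rightarrow> real" where
  "phase_speed N \<theta> = sqrt (1 - N\<^sup>2 * (1 + (sin \<theta>)\<^sup>2) / 2)"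

definition phase_time :: "real \<Rightarrow> real \<Rightarrow> real" where
  "phase_time N \<theta> = (LBINT \<phi>=0..\<theta>. 1 / phase_speed N \<phi>)"

definition quarter_period :: "real \<Rightarrow> real" where
  "quarter_period N = phase_time N (pi / 2)"

text \<open>Up to rescaling, \<open>phase_time\<close> is the incomplete elliptic integral of the first kind, its inverse \<open>phase\<close>
the Jacobi amplitude, and \<open>wave\<close> below the elliptic function sn.\<close>

definition phase :: "real \<Rightarrow> real \<Rightarrow> real" where
  "phase N = inv (phase_time N)"

definition wave :: "real \<Rightarrow> real \<Rightarrow> real" where
  "wave N t = N * sin (phase N t)"

definition wave_velocity :: "real \<Rightarrow> real \<Rightarrow> real" where
  "wave_velocity N t = N * cos (phase N t) * phase_speed N (phase N t)"

context
  fixes N :: real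
  assumes N_nonneg: "0 \<le> N" and N_less_1: "N < 1"
begin

lemma N_square_less_1: "N\<^sup>2 < 1"
  using N_nonneg N_less_1 by (simp add: abs_square_less_1)

lemma phase_speed_radicand_pos: "0 < 1 - N\<^sup>2 * (1 + (sin \<theta>)\<^sup>2) / 2"
proof -
  have "N\<^sup>2 * (1 + (sin \<theta>)\<^sup>2) \<le> N\<^sup>2 * 2"
    by (intro mult_left_mono) (auto simp: abs_square_le_1)
  then show ?thesis using N_square_less_1 by linarith
qed

lemma phase_speed_pos: "0 < phase_speed N \<theta>"
  using phase_speed_radicand_pos by (simp add: phase_speed_def)

lemma phase_speed_square: "(phase_speed N \<theta>)\<^sup>2 = 1 - N\<^sup>2 * (1 + (sin \<theta>)\<^sup>2) / 2"
  using phase_speed_radicand_pos[of \<theta>] by (simp add: phase_speed_def)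

lemma phase_speed_le_1: "phase_speed N \<theta> \<le> 1"
  by (simp add: phase_speed_def)

lemma phase_speed_has_derivative:
  "(phase_speed N has_real_derivative - (N\<^sup>2 * sin \<theta> * cos \<theta> / (2 * phase_speed N \<theta>))) (at \<theta>)"
  unfolding phase_speed_def
  using phase_speed_radicand_pos[of \<theta>]
  by (auto intro!: derivative_eq_intros simp: field_simps)

lemma continuous_on_phase_speed: "continuous_on A (phase_speed N)"
  by (rule has_real_derivative_imp_continuous_on[OF phase_speed_has_derivative])

lemma phase_time_has_derivative:
  "(phase_time N has_real_derivative 1 / phase_speed N \<theta>) (at \<theta>)"
proof -
  have cont: "continuous_on A (\<lambda>\<phi>. 1 / phase_speed N \<phi>)" for A
    by (intro continuous_intros continuous_on_phase_speed) (metis phase_speed_pos less_irrefl)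
  obtain F where F: "\<And>x. (F has_real_derivative 1 / phase_speed N x) (at x)"
    using primitive_exists[OF cont] by blast
  have "phase_time N x = F x - F 0" for x
  proof -
    have "(LBINT \<phi>=ereal 0..ereal x. 1 / phase_speed N \<phi>) = F x - F 0"
      by (rule interval_integral_FTC_finite[OF cont])
        (auto simp flip: has_real_derivative_iff_has_vector_derivative
          intro: has_field_derivative_at_within F)
    then show ?thesis
      by (simp add: phase_time_def zero_ereal_def)
  qed
  then have "phase_time N = (\<lambda>x. F x - F 0)" by blast
  then show ?thesis
    by (auto intro!: derivative_eq_intros F)
qed

lemma phase_time_0: "phase_time N 0 = 0"
  by (simp add: phase_time_def zero_ereal_def)

text \<open>The phase speed is even and has period \<open>\<pi>\<close>, so \<open>phase_time\<close> is odd and gains the same amount over every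
interval of length \<open>\<pi>\<close>; over \<open>[-\<pi>/2, \<pi>/2]\<close> this gain is two quarter periods.\<close>

lemma phase_time_shift: "phase_time N (x + pi) = phase_time N x + 2 * quarter_period N"
  and phase_time_minus: "phase_time N (- x) = - phase_time N x"
proof -
  have refl: "phase_time N x + phase_time N (0 - x) = phase_time N 0 + phase_time N (0 - 0)" for x
    by (rule derivative_reflect_const[OF phase_time_has_derivative]) (simp add: phase_speed_def)
  show minus: "phase_time N (- x) = - phase_time N x" for x
    using refl[of x] by (simp add: phase_time_0)
  have "phase_time N (x + pi) - phase_time N x = phase_time N (-(pi/2) + pi) - phase_time N (-(pi/2))"
    by (rule derivative_shift_const[OF phase_time_has_derivative]) (simp add: phase_speed_def)
  then show "phase_time N (x + pi) = phase_time N x + 2 * quarter_period N"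
    by (simp add: minus quarter_period_def)
qed

text \<open>Phase speeds are at most 1. The resulting linear growth makes \<open>phase_time\<close> a bijection of the line.\<close>

lemma phase_time_expands: "x \<le> y \<Longrightarrow> y - x \<le> phase_time N y - phase_time N x"
  using DERIV_nonneg_imp_nondecreasing[of x y "\<lambda>x. phase_time N x - x"]
  using phase_speed_pos phase_speed_le_1
  by (force intro!: exI[of _ "1 / phase_speed N _ - 1"] derivative_eq_intros phase_time_has_derivative)

lemma phase_time_strict_mono: "strict_mono (phase_time N)"
  using phase_time_expands by (intro strict_monoI) (smt (verit))

lemma phase_time_bij: "bij (phase_time N)"
proof (rule bijI)
  show "inj (phase_time N)"
    using phase_time_strict_mono strict_mono_imp_inj_on by blast
  have "\<exists>x. phase_time N x = y" for y
  proof -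
    have "phase_time N (- \<bar>y\<bar>) \<le> y" "y \<le> phase_time N \<bar>y\<bar>"
      using phase_time_expands[of "-\<bar>y\<bar>" 0] phase_time_expands[of 0 "\<bar>y\<bar>"]
      by (auto simp: phase_time_0)
    then show ?thesis
      using IVT'[of "phase_time N" "- \<bar>y\<bar>" y "\<bar>y\<bar>"]
        has_real_derivative_imp_continuous_on[OF phase_time_has_derivative]
      by auto
  qed
  then show "surj (phase_time N)"
    by (metis surjI surj_def)
qed

lemma phase_time_phase [simp]: "phase_time N (phase N t) = t"
  using phase_time_bij by (simp add: phase_def bij_is_surj surj_f_inv_f)

lemma phase_eq_iff: "phase N t = x \<longleftrightarrow> t = phase_time N x"
  using phase_time_strict_mono by (metis phase_time_phase strict_mono_eq)

lemma phase_le_iff: "phase N t \<le> x \<longleftrightarrow> t \<le> phase_time N x"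
  using phase_time_strict_mono by (metis phase_time_phase strict_mono_less_eq)

lemma phase_ge_iff: "x \<le> phase N t \<longleftrightarrow> phase_time N x \<le> t"
  using phase_time_strict_mono by (metis phase_time_phase strict_mono_less_eq)

lemma phase_0: "phase N 0 = 0"
  by (simp add: phase_eq_iff phase_time_0)

lemma phase_quarter: "phase N (quarter_period N) = pi / 2"
  by (subst phase_eq_iff) (simp add: quarter_period_def)

lemma phase_shift: "phase N (t + 2 * quarter_period N) = phase N t + pi"
  by (simp add: phase_eq_iff phase_time_shift)

lemma phase_minus: "phase N (- t) = - phase N t"
  by (simp add: phase_eq_iff phase_time_minus)

lemma phase_mono: "s \<le> t \<Longrightarrow> phase N s \<le> phase N t"
  by (simp add: phase_le_iff)

lemma quarter_period_pos: "0 < quarter_period N"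
  using phase_time_strict_mono phase_time_0
  by (metis quarter_period_def pi_half_gt_zero strict_monoD)

lemma phase_has_derivative:
  "(phase N has_real_derivative phase_speed N (phase N t)) (at t)"
proof -
  have "isCont (phase N) (phase_time N (phase N t))"
    by (rule isCont_inverse_function[of 1])
      (auto simp: phase_eq_iff intro: DERIV_isCont phase_time_has_derivative)
  then have "(phase N has_real_derivative inverse (1 / phase_speed N (phase N t))) (at t)"
    using phase_speed_pos[of "phase N t"]
    by (intro DERIV_inverse_function[OF phase_time_has_derivative, of _ _ "t - 1" "t + 1"]) auto
  then show ?thesis by simp
qed

section \<open>The periodic waves\<close>

lemma wave_has_derivative: "(wave N has_real_derivative wave_velocity N t) (at t)"
  unfolding wave_def[abs_def] wave_velocity_def
  by (auto intro!: derivative_eq_intros DERIV_chain2[OF DERIV_sin] phase_has_derivative)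

lemma wave_velocity_has_derivative:
  "(wave_velocity N has_real_derivative (wave N t) ^ 3 - wave N t) (at t)"
proof -
  let ?\<theta> = "phase N t" and ?\<omega> = "phase_speed N (phase N t)"
  have pos: "0 < ?\<omega>" by (rule phase_speed_pos)
  have sq: "?\<omega> * ?\<omega> = 1 - N\<^sup>2 * (1 + (sin ?\<theta>)\<^sup>2) / 2"
    using phase_speed_square[of ?\<theta>] by (simp add: power2_eq_square)
  have "(wave_velocity N has_real_derivative
      - (N * sin ?\<theta> * (?\<omega> * ?\<omega>)) - N * cos ?\<theta> * (N\<^sup>2 * sin ?\<theta> * cos ?\<theta> / 2)) (at t)"
    unfolding wave_velocity_def[abs_def] using pos
    by (auto intro!: derivative_eq_intros phase_has_derivative
        DERIV_chain2[OF phase_speed_has_derivative] simp: field_simps)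
  also have "- (N * sin ?\<theta> * (?\<omega> * ?\<omega>)) - N * cos ?\<theta> * (N\<^sup>2 * sin ?\<theta> * cos ?\<theta> / 2)
      = (wave N t) ^ 3 - wave N t - N ^ 3 * sin ?\<theta> / 2 * ((sin ?\<theta>)\<^sup>2 + (cos ?\<theta>)\<^sup>2 - 1)"
    \<comment> \<open>The last summand is zero; with it both sides agree as polynomials in sine and cosine.\<close>
    unfolding sq wave_def by algebra
  finally show ?thesis by simp
qed

lemma wave_velocity_square:
  "2 * (wave_velocity N t)\<^sup>2 = (1 - (wave N t)\<^sup>2)\<^sup>2 - (1 - N\<^sup>2)\<^sup>2"
proof -
  let ?\<theta> = "phase N t"
  have "(cos ?\<theta>)\<^sup>2 = 1 - (sin ?\<theta>)\<^sup>2" by (simp add: cos_squared_eq)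
  then have "2 * (wave_velocity N t)\<^sup>2
      = N\<^sup>2 * (1 - (sin ?\<theta>)\<^sup>2) * (2 - N\<^sup>2 * (1 + (sin ?\<theta>)\<^sup>2))"
    unfolding wave_velocity_def power_mult_distrib phase_speed_square by simp
  then show ?thesis
    by (simp add: wave_def power2_eq_square algebra_simps)
qed

lemma abs_wave_le: "\<bar>wave N t\<bar> \<le> N"
  unfolding wave_def abs_mult using N_nonneg abs_sin_le_one[of "phase N t"]
  by (simp add: mult_left_le)

lemma wave_0: "wave N 0 = 0"
  by (simp add: wave_def phase_0)

lemma wave_quarter: "wave N (quarter_period N) = N"
  by (simp add: wave_def phase_quarter)

lemma wave_velocity_quarter: "wave_velocity N (quarter_period N) = 0"
  by (simp add: wave_velocity_def phase_quarter)

lemma wave_minus: "wave N (- t) = - wave N t"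
  by (simp add: wave_def phase_minus)

lemma wave_shift: "wave N (t + 2 * quarter_period N) = - wave N t"
  by (simp add: wave_def phase_shift)

lemma wave_reflect: "wave N (2 * quarter_period N - t) = wave N t"
  using wave_shift[of "- t"] by (simp add: wave_minus)

lemma phase_quarter_bounds:
  assumes "0 \<le> t" "t \<le> quarter_period N"
  shows "0 \<le> phase N t" "phase N t \<le> pi / 2"
  using assms phase_mono[of 0 t] phase_mono[of t "quarter_period N"]
  by (auto simp: phase_0 phase_quarter)

lemma wave_mono:
  assumes "0 \<le> s" "s \<le> t" "t \<le> quarter_period N"
  shows "wave N s \<le> wave N t"
  unfolding wave_def using phase_quarter_bounds[of s] phase_quarter_bounds[of t] assms N_nonneg
  by (intro mult_left_mono sin_monotone_2pi_le phase_mono) auto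

text \<open>If \<open>p\<close> is a period, then the phase one period after the maximum at the quarter period is again a
point where the sine is 1, so it is \<open>\<pi>/2\<close> plus a multiple of \<open>2 \<pi>\<close>; as \<open>phase_time\<close> turns phase
increments \<open>\<pi>\<close> into time increments of two quarter periods, \<open>p\<close> is a multiple of the full period.\<close>

lemma wave_period_multiple:
  assumes "0 < N" and per: "\<And>t. wave N (t + p) = wave N t"
  obtains k :: int where "p = 4 * of_int k * quarter_period N"
proof -
  let ?T = "quarter_period N"
  have "sin (phase N (?T + p)) = 1"
    using per[of ?T] \<open>0 < N\<close> by (simp add: wave_def phase_quarter)
  then obtain k :: int where k: "phase N (?T + p) = of_int (2 * k) * pi + pi / 2"
    by (auto simp: sin_eq_1 algebra_simps)
  have shifts: "phase_time N (x + of_nat n * pi) = phase_time N x + of_nat n * (2 * ?T)" for x n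
  proof (induction n)
    case (Suc n)
    then show ?case
      using phase_time_shift[of "x + of_nat n * pi"] by (simp add: algebra_simps)
  qed simp
  have "phase_time N (x + of_int m * pi) = phase_time N x + of_int m * (2 * ?T)" for x m
    using shifts[of x "nat m"] shifts[of "x + of_int m * pi" "nat (- m)"]
    by (cases "0 \<le> m") (auto simp: algebra_simps)
  from this[of "pi / 2" "2 * k"] have "?T + p = ?T + of_int (2 * k) * (2 * ?T)"
    using k by (simp add: phase_eq_iff quarter_period_def add.commute)
  then show ?thesis using that[of k] by simp
qed

end

section \<open>The quarter period as a function of the amplitude\<close>

lemma phase_speed_strict_antimono:
  assumes "0 \<le> M" "M < N" "N < 1"
  shows "phase_speed N \<theta> < phase_speed M \<theta>"
proof -
  have "M\<^sup>2 * (1 + (sin \<theta>)\<^sup>2) < N\<^sup>2 * (1 + (sin \<theta>)\<^sup>2)"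
    using assms by (intro mult_strict_right_mono power_strict_mono) (auto simp: add_pos_nonneg)
  then show ?thesis
    by (simp add: phase_speed_def)
qed

lemma quarter_period_strict_mono:
  assumes "0 \<le> M" "M < N" "N < 1"
  shows "quarter_period M < quarter_period N"
proof -
  have "phase_time N 0 - phase_time M 0 < phase_time N (pi / 2) - phase_time M (pi / 2)"
  proof (rule DERIV_pos_imp_increasing[where f = "\<lambda>\<theta>. phase_time N \<theta> - phase_time M \<theta>"])
    fix \<theta>
    have "((\<lambda>\<theta>. phase_time N \<theta> - phase_time M \<theta>) has_real_derivative
        1 / phase_speed N \<theta> - 1 / phase_speed M \<theta>) (at \<theta>)"
      using assms by (intro DERIV_diff phase_time_has_derivative) auto
    moreover have "1 / phase_speed M \<theta> < 1 / phase_speed N \<theta>"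
      using assms phase_speed_strict_antimono[OF assms] phase_speed_pos[of N \<theta>]
      by (intro divide_strict_left_mono) (auto intro!: mult_pos_pos intro: phase_speed_pos)
    ultimately show "\<exists>y. ((\<lambda>\<theta>. phase_time N \<theta> - phase_time M \<theta>) has_real_derivative y) (at \<theta>) \<and> 0 < y"
      by (auto intro!: exI[of _ "1 / phase_speed N \<theta> - 1 / phase_speed M \<theta>"])
  qed simp
  then show ?thesis
    using assms by (simp add: quarter_period_def phase_time_0)
qed

lemma quarter_period_inj:
  assumes "0 \<le> M" "M < 1" "0 \<le> N" "N < 1" "quarter_period M = quarter_period N"
  shows "M = N"
  using assms quarter_period_strict_mono[of M N] quarter_period_strict_mono[of N M]
  by (cases M N rule: linorder_cases) auto

lemma quarter_period_0: "quarter_period 0 = pi / 2"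
proof -
  have "phase_time 0 (pi / 2) - pi / 2 = phase_time 0 0 - 0"
    by (rule DERIV_isconst_all[where f = "\<lambda>x. phase_time 0 x - x"])
      (auto intro!: derivative_eq_intros phase_time_has_derivative simp: phase_speed_def)
  then show ?thesis
    by (simp add: quarter_period_def phase_time_0)
qed

lemma has_integral_quarter_period:
  assumes "0 \<le> N" "N < 1"
  shows "((\<lambda>\<theta>. 1 / phase_speed N \<theta>) has_integral quarter_period N) {0..pi / 2}"
proof -
  have "((\<lambda>\<theta>. 1 / phase_speed N \<theta>) has_integral phase_time N (pi / 2) - phase_time N 0) {0..pi / 2}"
    using phase_time_has_derivative[OF assms]
    by (intro fundamental_theorem_of_calculus)
      (auto simp flip: has_real_derivative_iff_has_vector_derivative
        intro: has_field_derivative_at_within)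
  then show ?thesis
    using assms by (simp add: quarter_period_def phase_time_0)
qed

lemma set_integral_quarter_period:
  assumes "0 \<le> N" "N < 1"
  shows "(LINT \<theta>:{0..pi/2}|lebesgue. 1 / sqrt (2 - N\<^sup>2 * (1 + (sin \<theta>)\<^sup>2))) = quarter_period N / sqrt 2"
proof -
  have eq: "1 / sqrt (2 - N\<^sup>2 * (1 + (sin \<theta>)\<^sup>2)) = 1 / phase_speed N \<theta> / sqrt 2" for \<theta>
  proof -
    have "2 - N\<^sup>2 * (1 + (sin \<theta>)\<^sup>2) = (1 - N\<^sup>2 * (1 + (sin \<theta>)\<^sup>2) / 2) * 2" by simp
    then show ?thesis
      unfolding phase_speed_def by (simp only: real_sqrt_mult) simp
  qed
  have der: "((\<lambda>\<theta>. phase_time N \<theta> / sqrt 2) has_real_derivative 1 / phase_speed N \<theta> / sqrt 2) (at \<theta>)" for \<theta>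
    using assms by (intro DERIV_cdivide phase_time_has_derivative)
  have cont: "continuous_on {0..pi/2} (\<lambda>\<theta>. 1 / phase_speed N \<theta> / sqrt 2)"
    using phase_speed_pos[OF assms] continuous_on_phase_speed[OF assms]
    by (intro continuous_intros) (auto simp: less_imp_neq[symmetric])
  show ?thesis
    unfolding eq using set_lebesgue_integral_FTC[OF _ cont der] assms
    by (simp add: quarter_period_def phase_time_0)
qed

lemma continuous_on_quarter_period: "continuous_on {0..<1} quarter_period"
proof -
  have "continuous_on ({0..<1} \<times> cbox 0 (pi / 2)) (\<lambda>(N, \<theta>). 1 / phase_speed N \<theta>)"
    unfolding case_prod_beta
  proof (intro continuous_intros)
    show "continuous_on ({0..<1} \<times> cbox 0 (pi / 2)) (\<lambda>p. phase_speed (fst p) (snd p))"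
      unfolding phase_speed_def by (intro continuous_intros) auto
    show "\<forall>p\<in>{0..<1} \<times> cbox 0 (pi / 2). phase_speed (fst p) (snd p) \<noteq> 0"
      using phase_speed_pos by (fastforce simp: less_imp_neq[symmetric])
  qed
  then have "continuous_on {0..<1} (\<lambda>N. integral (cbox 0 (pi / 2)) (\<lambda>\<theta>. 1 / phase_speed N \<theta>))"
    by (rule integral_continuous_on_param)
  then show ?thesis
    by (rule continuous_on_cong[THEN iffD1, rotated -1])
      (use has_integral_quarter_period in \<open>auto simp: integral_unique\<close>)
qed

lemma artanh_le_imp_le:
  fixes x y :: real
  assumes "artanh x \<le> artanh y" "\<bar>x\<bar> < 1" "\<bar>y\<bar> < 1"
  shows "x \<le> y"
proof -
  have "0 < (1 + x) / (1 - x)" "0 < (1 + y) / (1 - y)"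
    using assms by (auto intro!: divide_pos_pos)
  then have "(1 + x) / (1 - x) \<le> (1 + y) / (1 - y)"
    using assms by (simp add: artanh_def)
  then show ?thesis
    using assms by (simp add: field_simps)
qed

text \<open>The conservation law gives \<open>sqrt 2 v' \<le> 1 - v\<^sup>2\<close>, so the derivative of \<open>artanh v\<close> is at most \<open>1 / sqrt 2\<close>,
which is the derivative of \<open>artanh\<close> along the heteroclinic solution.\<close>

lemma wave_le_tanh:
  assumes N: "0 \<le> N" "N < 1" and "0 \<le> t"
  shows "wave N t \<le> tanh (t / sqrt 2)"
proof -
  have bound: "\<bar>wave N s\<bar> < 1" for s
    using abs_wave_le[OF N, of s] N by simp
  have "artanh (wave N t) - t / sqrt 2 \<le> artanh (wave N 0) - 0 / sqrt 2"
  proof (rule DERIV_nonpos_imp_nonincreasing[OF \<open>0 \<le> t\<close>,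
        where f = "\<lambda>s. artanh (wave N s) - s / sqrt 2"])
    fix s
    have pos: "0 < 1 - (wave N s)\<^sup>2"
      using bound[of s] by (simp add: abs_square_less_1)
    have "2 * (wave_velocity N s)\<^sup>2 \<le> (1 - (wave N s)\<^sup>2)\<^sup>2"
      unfolding wave_velocity_square[OF N] by simp
    then have "(sqrt 2 * wave_velocity N s)\<^sup>2 \<le> (1 - (wave N s)\<^sup>2)\<^sup>2"
      by (simp add: power_mult_distrib)
    then have "sqrt 2 * wave_velocity N s \<le> 1 - (wave N s)\<^sup>2"
      using pos by (meson less_imp_le power2_le_imp_le)
    then have "wave_velocity N s / (1 - (wave N s)\<^sup>2) - 1 / sqrt 2 \<le> 0"
      using pos by (simp add: field_simps)
    moreover have "((\<lambda>s. artanh (wave N s) - s / sqrt 2) has_real_derivative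
        wave_velocity N s / (1 - (wave N s)\<^sup>2) - 1 / sqrt 2) (at s)"
      using bound[of s]
        DERIV_chain2[OF artanh_real_has_field_derivative wave_has_derivative[OF N]]
      by (intro DERIV_diff DERIV_cdivide DERIV_ident) simp
    ultimately show "\<exists>y. ((\<lambda>s. artanh (wave N s) - s / sqrt 2) has_real_derivative y) (at s) \<and> y \<le> 0"
      by blast
  qed
  then have "artanh (wave N t) \<le> artanh (tanh (t / sqrt 2))"
    using N by (simp add: wave_0 artanh_tanh_real)
  then show ?thesis
    by (rule artanh_le_imp_le) (use bound tanh_real_bounds[of "t / sqrt 2"] in auto)
qed

text \<open>This is what forces the quarter period to be unbounded as the amplitude tends to 1.\<close>

lemma amplitude_le_tanh:
  assumes "0 \<le> N" "N < 1"
  shows "N \<le> tanh (quarter_period N / sqrt 2)"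
  using wave_le_tanh[OF assms, of "quarter_period N"] quarter_period_pos[OF assms]
  by (simp add: wave_quarter[OF assms])

text \<open>Intermediate value theorem. An amplitude \<open>R < 1\<close> above \<open>tanh (L / sqrt 2)\<close> has quarter period at
least \<open>L\<close> by \<open>amplitude_le_tanh\<close>.\<close>

lemma quarter_period_surj:
  assumes "pi / 2 < L"
  obtains N where "0 < N" "N < 1" "quarter_period N = L"
proof -
  let ?h = "tanh (L / sqrt 2)"
  obtain R where R: "?h < R" "R < 1"
    using tanh_real_lt_1 dense by blast
  have "0 < L" using assms pi_gt_zero by linarith
  then have "0 < ?h" by simp
  with R have R0: "0 < R" by linarith
  have "?h < tanh (quarter_period R / sqrt 2)"
    using amplitude_le_tanh[of R] R R0 by linarith
  then have "L / sqrt 2 < quarter_period R / sqrt 2"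
    by (rule contrapos_pp)
      (use tanh_real_strict_mono in \<open>auto simp: not_less strict_mono_less_eq divide_right_mono\<close>)
  then have "L \<le> quarter_period R" by (simp add: divide_less_cancel)
  moreover have "continuous_on {0..R} quarter_period"
    using continuous_on_quarter_period by (rule continuous_on_subset) (use R in auto)
  ultimately obtain N where N: "0 \<le> N" "N \<le> R" "quarter_period N = L"
    using IVT'[of quarter_period 0 L R] assms R0 by (auto simp: quarter_period_0)
  moreover have "N \<noteq> 0" using N assms by (auto simp: quarter_period_0)
  ultimately show ?thesis using that[of N] R by auto
qed

section \<open>Solutions of the equation\<close>

lemma DERIV_affine:
  fixes f :: "real \<Rightarrow> real"
  assumes "\<And>x. (f has_real_derivative f' x) (at x)"
  shows "((\<lambda>x. f (c * x + b)) has_real_derivative c * f' (c * x + b)) (at x)"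
proof -
  have "((\<lambda>x. c * x + b) has_real_derivative c) (at x)"
    by (auto intro!: derivative_eq_intros)
  from DERIV_chain2[OF assms this] show ?thesis by (simp add: mult.commute)
qed

lemma allen_cahn_solutionI:
  assumes "\<kappa> \<noteq> 0" "\<And>x. (u has_real_derivative v x) (at x)"
    "\<And>x. (v has_real_derivative ((u x) ^ 3 - u x) / \<kappa>\<^sup>2) (at x)"
  shows "allen_cahn_solution \<kappa> u"
  unfolding allen_cahn_solution_def
  using assms by (intro exI[of _ v] exI[of _ "\<lambda>x. ((u x) ^ 3 - u x) / \<kappa>\<^sup>2"]) auto

lemma allen_cahn_solutionE:
  assumes "allen_cahn_solution \<kappa> u" "\<kappa> \<noteq> 0"
  obtains v where "\<And>x. (u has_real_derivative v x) (at x)"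
    "\<And>x. (v has_real_derivative ((u x) ^ 3 - u x) / \<kappa>\<^sup>2) (at x)"
proof -
  obtain v w where vw: "\<And>x. (u has_real_derivative v x) (at x)"
    "\<And>x. (v has_real_derivative w x) (at x)" "\<And>x. \<kappa>\<^sup>2 * w x + u x - (u x) ^ 3 = 0"
    using assms unfolding allen_cahn_solution_def by blast
  have "w x = ((u x) ^ 3 - u x) / \<kappa>\<^sup>2" for x
    using vw(3)[of x] \<open>\<kappa> \<noteq> 0\<close> by (simp add: field_simps)
  then show ?thesis using that[of v] vw by auto
qed

lemma allen_cahn_solution_affine:
  assumes "allen_cahn_solution \<kappa> u" "\<kappa> \<noteq> 0" "c \<noteq> 0"
  shows "allen_cahn_solution (\<kappa> / c) (\<lambda>x. u (c * x + b))"
proof -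
  obtain v where v: "\<And>x. (u has_real_derivative v x) (at x)"
    "\<And>x. (v has_real_derivative ((u x) ^ 3 - u x) / \<kappa>\<^sup>2) (at x)"
    using allen_cahn_solutionE[OF assms(1,2)] by blast
  show ?thesis
  proof (rule allen_cahn_solutionI)
    show "((\<lambda>x. u (c * x + b)) has_real_derivative c * v (c * x + b)) (at x)" for x
      by (rule DERIV_affine[OF v(1)])
    show "((\<lambda>x. c * v (c * x + b)) has_real_derivative
        ((u (c * x + b)) ^ 3 - u (c * x + b)) / (\<kappa> / c)\<^sup>2) (at x)" for x
      using \<open>c \<noteq> 0\<close>
      by (auto intro!: derivative_eq_intros DERIV_affine[OF v(2)] simp: power2_eq_square)
  qed (use assms in auto)
qed

lemma allen_cahn_solution_minus:
  assumes "allen_cahn_solution \<kappa> u" "\<kappa> \<noteq> 0"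
  shows "allen_cahn_solution \<kappa> (\<lambda>x. - u x)"
proof -
  obtain v where v: "\<And>x. (u has_real_derivative v x) (at x)"
    "\<And>x. (v has_real_derivative ((u x) ^ 3 - u x) / \<kappa>\<^sup>2) (at x)"
    using allen_cahn_solutionE[OF assms] by blast
  show ?thesis
    by (rule allen_cahn_solutionI[where v = "\<lambda>x. - v x"])
      (use assms in \<open>auto intro!: derivative_eq_intros v simp: diff_divide_distrib\<close>)
qed

lemma allen_cahn_solution_wave:
  assumes "0 \<le> N" "N < 1"
  shows "allen_cahn_solution 1 (wave N)"
  using wave_has_derivative[OF assms] wave_velocity_has_derivative[OF assms]
  by (intro allen_cahn_solutionI[where v = "wave_velocity N"]) auto

lemma allen_cahn_solution_const:
  assumes "c ^ 3 = c"
  shows "allen_cahn_solution \<kappa> (\<lambda>x. c)"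
  unfolding allen_cahn_solution_def using assms
  by (intro exI[of _ "\<lambda>x. 0"]) auto

text \<open>Gronwall's argument: the squared distance \<open>D\<close> of the two trajectories in the phase plane satisfies
\<open>\<bar>D'\<bar> \<le> 3 D\<close>, so its product with \<open>exp (-3 t)\<close> decreases and that with \<open>exp (3 t)\<close> increases. The bound
1 on both solutions provides the Lipschitz constant of the cubic.\<close>

lemma unit_solution_unique:
  fixes u v a b :: "real \<Rightarrow> real"
  assumes u: "\<And>x. (u has_real_derivative v x) (at x)"
      "\<And>x. (v has_real_derivative (u x) ^ 3 - u x) (at x)"
    and a: "\<And>x. (a has_real_derivative b x) (at x)"
      "\<And>x. (b has_real_derivative (a x) ^ 3 - a x) (at x)"
    and bounds: "\<And>x. \<bar>u x\<bar> \<le> 1" "\<And>x. \<bar>a x\<bar> \<le> 1"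
    and init: "u t0 = a t0" "v t0 = b t0"
  shows "u t = a t"
proof -
  define D where "D x = (u x - a x)\<^sup>2 + (v x - b x)\<^sup>2" for x
  define D' where "D' x = 2 * ((u x - a x) * (v x - b x)) * ((u x)\<^sup>2 + u x * a x + (a x)\<^sup>2)" for x
  have D: "(D has_real_derivative D' x) (at x)" for x
  proof -
    have "(D has_real_derivative 2 * (u x - a x) * (v x - b x)
        + 2 * (v x - b x) * (((u x) ^ 3 - u x) - ((a x) ^ 3 - a x))) (at x)"
      unfolding D_def[abs_def]
      by (auto intro!: derivative_eq_intros u a simp: algebra_simps)
    also have "2 * (u x - a x) * (v x - b x)
        + 2 * (v x - b x) * (((u x) ^ 3 - u x) - ((a x) ^ 3 - a x)) = D' x"
      unfolding D'_def by algebra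
    finally show ?thesis .
  qed
  have D'_bound: "\<bar>D' x\<bar> \<le> 3 * D x" for x
  proof -
    have "\<bar>u x * a x\<bar> \<le> 1 * 1"
      unfolding abs_mult using bounds by (intro mult_mono) auto
    moreover have "(u x)\<^sup>2 \<le> 1" "(a x)\<^sup>2 \<le> 1"
      using bounds by (auto simp: abs_square_le_1)
    ultimately have q: "\<bar>(u x)\<^sup>2 + u x * a x + (a x)\<^sup>2\<bar> \<le> 3"
      using zero_le_power2[of "u x"] zero_le_power2[of "a x"] by linarith
    have p: "\<bar>2 * ((u x - a x) * (v x - b x))\<bar> \<le> D x"
    proof -
      have "0 \<le> (u x - a x + (v x - b x))\<^sup>2" "0 \<le> (u x - a x - (v x - b x))\<^sup>2" by simp_all
      then show ?thesis
        unfolding D_def power2_sum[of "u x - a x"] power2_diff[of "u x - a x"] by linarith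
    qed
    have "\<bar>D' x\<bar> \<le> D x * 3"
      unfolding D'_def abs_mult[of "2 * _"] using p q by (intro mult_mono) (auto simp: D_def)
    then show ?thesis by simp
  qed
  have "D t \<le> 0"
  proof (cases "t0 \<le> t")
    case True
    have "exp (- 3 * t) * D t \<le> exp (- 3 * t0) * D t0"
    proof (rule DERIV_nonpos_imp_nonincreasing[OF True, where f = "\<lambda>x. exp (- 3 * x) * D x"])
      fix x
      have "((\<lambda>x. exp (- 3 * x) * D x) has_real_derivative exp (- 3 * x) * (D' x - 3 * D x)) (at x)"
        by (auto intro!: derivative_eq_intros D simp: algebra_simps)
      moreover have "exp (- 3 * x) * (D' x - 3 * D x) \<le> 0"
        using D'_bound[of x] by (simp add: mult_le_0_iff)
      ultimately show "\<exists>y. ((\<lambda>x. exp (- 3 * x) * D x) has_real_derivative y) (at x) \<and> y \<le> 0"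
        by blast
    qed
    then show ?thesis by (simp add: D_def init mult_le_0_iff)
  next
    case False
    then have "t \<le> t0" by simp
    then have "exp (3 * t) * D t \<le> exp (3 * t0) * D t0"
    proof (rule DERIV_nonneg_imp_nondecreasing[where f = "\<lambda>x. exp (3 * x) * D x"])
      fix x
      have "((\<lambda>x. exp (3 * x) * D x) has_real_derivative exp (3 * x) * (D' x + 3 * D x)) (at x)"
        by (auto intro!: derivative_eq_intros D simp: algebra_simps)
      moreover have "0 \<le> exp (3 * x) * (D' x + 3 * D x)"
        using D'_bound[of x] by simp
      ultimately show "\<exists>y. ((\<lambda>x. exp (3 * x) * D x) has_real_derivative y) (at x) \<and> 0 \<le> y"
        by blast
    qed
    then show ?thesis by (simp add: D_def init mult_le_0_iff)
  qed
  then show ?thesis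
    unfolding D_def by (smt (verit) zero_le_power2 power_eq_0_iff)
qed

lemma solution_unique:
  assumes sol: "allen_cahn_solution \<kappa> u" "allen_cahn_solution \<kappa> w" and "\<kappa> \<noteq> 0"
    and bounds: "\<And>x. \<bar>u x\<bar> \<le> 1" "\<And>x. \<bar>w x\<bar> \<le> 1"
    and init: "u x0 = w x0" "deriv u x0 = deriv w x0"
  shows "u = w"
proof
  fix x
  obtain v where v: "\<And>x. (u has_real_derivative v x) (at x)"
    "\<And>x. (v has_real_derivative ((u x) ^ 3 - u x) / \<kappa>\<^sup>2) (at x)"
    using allen_cahn_solutionE[OF sol(1) \<open>\<kappa> \<noteq> 0\<close>] by blast
  obtain z where z: "\<And>x. (w has_real_derivative z x) (at x)"
    "\<And>x. (z has_real_derivative ((w x) ^ 3 - w x) / \<kappa>\<^sup>2) (at x)"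
    using allen_cahn_solutionE[OF sol(2) \<open>\<kappa> \<noteq> 0\<close>] by blast
  have "v x0 = z x0"
    using init(2) DERIV_imp_deriv[OF v(1)] DERIV_imp_deriv[OF z(1)] by simp
  have "u (\<kappa> * (x / \<kappa>)) = w (\<kappa> * (x / \<kappa>))"
  proof (rule unit_solution_unique[where u = "\<lambda>t. u (\<kappa> * t)" and v = "\<lambda>t. \<kappa> * v (\<kappa> * t)"
        and a = "\<lambda>t. w (\<kappa> * t)" and b = "\<lambda>t. \<kappa> * z (\<kappa> * t)" and ?t0.0 = "x0 / \<kappa>"])
    fix t
    show "((\<lambda>t. u (\<kappa> * t)) has_real_derivative \<kappa> * v (\<kappa> * t)) (at t)"
      using DERIV_affine[OF v(1), of \<kappa> 0] by simp
    show "((\<lambda>t. w (\<kappa> * t)) has_real_derivative \<kappa> * z (\<kappa> * t)) (at t)"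
      using DERIV_affine[OF z(1), of \<kappa> 0] by simp
    show "((\<lambda>t. \<kappa> * v (\<kappa> * t)) has_real_derivative (u (\<kappa> * t)) ^ 3 - u (\<kappa> * t)) (at t)"
      using \<open>\<kappa> \<noteq> 0\<close> DERIV_cmult[OF DERIV_affine[OF v(2), of \<kappa> 0], of \<kappa>]
      by (simp add: power2_eq_square)
    show "((\<lambda>t. \<kappa> * z (\<kappa> * t)) has_real_derivative (w (\<kappa> * t)) ^ 3 - w (\<kappa> * t)) (at t)"
      using \<open>\<kappa> \<noteq> 0\<close> DERIV_cmult[OF DERIV_affine[OF z(2), of \<kappa> 0], of \<kappa>]
      by (simp add: power2_eq_square)
  qed (use bounds init(1) \<open>\<kappa> \<noteq> 0\<close> \<open>v x0 = z x0\<close> in auto)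
  then show "u x = w x" using \<open>\<kappa> \<noteq> 0\<close> by simp
qed

section \<open>Periodic solutions\<close>

lemma periodic_2pi_of_int:
  assumes "periodic_2pi u"
  shows "u (x + of_int k * (2 * pi)) = u x"
proof -
  have nat: "u (x + of_nat n * (2 * pi)) = u x" for x n
  proof (induction n)
    case (Suc n)
    have "u (x + of_nat (Suc n) * (2 * pi)) = u (x + of_nat n * (2 * pi) + 2 * pi)"
      by (simp add: algebra_simps)
    then show ?case using assms Suc by (simp add: periodic_2pi_def)
  qed simp
  show ?thesis
    using nat[of x "nat k"] nat[of "x + of_int k * (2 * pi)" "nat (- k)"]
    by (cases "0 \<le> k") (auto simp: algebra_simps)
qed

lemma periodic_attains_max:
  assumes per: "periodic_2pi u" and cont: "continuous_on UNIV u"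
  obtains x0 where "\<And>x. u x \<le> u x0"
proof -
  have "\<exists>x0\<in>{0..2 * pi}. \<forall>x\<in>{0..2 * pi}. u x \<le> u x0"
    by (rule continuous_attains_sup) (auto intro: continuous_on_subset[OF cont])
  then obtain x0 where x0: "\<And>x. 0 \<le> x \<Longrightarrow> x \<le> 2 * pi \<Longrightarrow> u x \<le> u x0"
    by (metis atLeastAtMost_iff)
  have "u x \<le> u x0" for x
  proof -
    define y where "y = x + of_int (- \<lfloor>x / (2 * pi)\<rfloor>) * (2 * pi)"
    have "0 \<le> y" "y \<le> 2 * pi"
      unfolding y_def using floor_divide_lower[of "2 * pi" x] floor_divide_upper[of "2 * pi" x]
      by (auto simp: algebra_simps)
    then have "u y \<le> u x0" by (rule x0)
    then show ?thesis unfolding y_def periodic_2pi_of_int[OF per] .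
  qed
  then show ?thesis using that by blast
qed

text \<open>The second derivative test: \<open>(u x0)\<^sup>3 - u x0\<close> has the sign of the second derivative at the maximum.\<close>

lemma solution_at_maximum:
  assumes "allen_cahn_solution \<kappa> u" "\<kappa> \<noteq> 0" and max: "\<And>x. u x \<le> u x0"
  shows "deriv u x0 = 0" "(u x0) ^ 3 \<le> u x0"
proof -
  obtain v where v: "\<And>x. (u has_real_derivative v x) (at x)"
    "\<And>x. (v has_real_derivative ((u x) ^ 3 - u x) / \<kappa>\<^sup>2) (at x)"
    using allen_cahn_solutionE[OF assms(1,2)] by blast
  have v0: "v x0 = 0"
    using DERIV_local_max[OF v(1), of 1] max by auto
  then show "deriv u x0 = 0"
    using DERIV_imp_deriv[OF v(1)] by simp
  show "(u x0) ^ 3 \<le> u x0"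
  proof (rule ccontr)
    assume "\<not> (u x0) ^ 3 \<le> u x0"
    then have "0 < ((u x0) ^ 3 - u x0) / \<kappa>\<^sup>2" using \<open>\<kappa> \<noteq> 0\<close> by simp
    then obtain d where d: "0 < d" "\<And>h. 0 < h \<Longrightarrow> h < d \<Longrightarrow> v x0 < v (x0 + h)"
      using DERIV_pos_inc_right[OF v(2)[of x0]] by auto
    have "u x0 < u (x0 + d / 2)"
    proof (rule DERIV_pos_imp_increasing_open[where f = u])
      fix x assume "x0 < x" "x < x0 + d / 2"
      then have "0 < v x" using d(2)[of "x - x0"] v0 by auto
      then show "\<exists>y. (u has_real_derivative y) (at x) \<and> 0 < y" using v(1) by blast
    qed (use d has_real_derivative_imp_continuous_on[OF v(1)] in auto)
    then show False using max[of "x0 + d / 2"] by simp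
  qed
qed

lemma cube_le_self_imp:
  fixes M :: real
  assumes "M ^ 3 \<le> M"
  shows "M \<le> - 1 \<or> 0 \<le> M" "M \<le> 1"
proof -
  have "M * ((M - 1) * (M + 1)) \<le> 0"
    using assms by (simp add: power3_eq_cube algebra_simps)
  then show "M \<le> - 1 \<or> 0 \<le> M" "M \<le> 1"
    by (smt (verit) mult_pos_pos mult_neg_neg mult_neg_pos mult_pos_neg)+
qed

lemma solution_continuous:
  assumes "allen_cahn_solution \<kappa> u"
  shows "continuous_on A u"
  using assms has_real_derivative_imp_continuous_on[of u]
  unfolding allen_cahn_solution_def by blast

lemma periodic_solution_le_1:
  assumes sol: "allen_cahn_solution \<kappa> u" "\<kappa> \<noteq> 0" and per: "periodic_2pi u"
  shows "u x \<le> 1"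
proof -
  obtain x0 where "\<And>x. u x \<le> u x0"
    using periodic_attains_max[OF per solution_continuous[OF sol(1)]] by blast
  then show ?thesis
    using solution_at_maximum(2)[OF sol] cube_le_self_imp(2) order_trans by blast
qed

text \<open>The lower bound is the upper bound for the solution \<open>-u\<close>.\<close>

lemma periodic_solution_bounded:
  assumes sol: "allen_cahn_solution \<kappa> u" "\<kappa> \<noteq> 0" and per: "periodic_2pi u"
  shows "\<bar>u x\<bar> \<le> 1"
  using periodic_solution_le_1[OF assms, of x]
    periodic_solution_le_1[OF allen_cahn_solution_minus[OF sol], of x] per sol
  by (auto simp: periodic_2pi_def)

text \<open>The solution is compared at its maximum \<open>x0\<close>, where its derivative vanishes, with the constants
(if the maximum \<open>N\<close> is a root of \<open>N\<^sup>3 = N\<close>) and otherwise with the wave of amplitude \<open>N\<close>, shifted so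
that its own maximum lies at \<open>x0\<close>. The integer \<open>j\<close> counts the periods of the wave in an interval of
length \<open>2 \<pi>\<close>.\<close>

lemma periodic_solution_classification:
  assumes "0 < \<kappa>" and sol: "allen_cahn_solution \<kappa> u" and per: "periodic_2pi u"
    and nonconst: "u \<noteq> (\<lambda>x. 1)" "u \<noteq> (\<lambda>x. - 1)" "u \<noteq> (\<lambda>x. 0)"
  obtains N j a where "0 < N" "N < 1" "1 \<le> (j::nat)"
    "quarter_period N = pi / (2 * (of_nat j * \<kappa>))" "u = (\<lambda>x. wave N ((x + a) / \<kappa>))"
proof -
  have "\<kappa> \<noteq> 0" using \<open>0 < \<kappa>\<close> by simp
  have bound: "\<bar>u x\<bar> \<le> 1" for x
    by (rule periodic_solution_bounded[OF sol \<open>\<kappa> \<noteq> 0\<close> per])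
  obtain x0 where x0: "\<And>x. u x \<le> u x0"
    using periodic_attains_max[OF per solution_continuous[OF sol]] by blast
  define N where "N = u x0"
  note crit = solution_at_maximum[OF sol \<open>\<kappa> \<noteq> 0\<close> x0]
  have not_root: False if "N ^ 3 = N"
  proof -
    have "u = (\<lambda>x. N)"
      by (rule solution_unique[OF sol allen_cahn_solution_const[OF that] \<open>\<kappa> \<noteq> 0\<close> bound, of x0])
        (use bound[of x0] crit in \<open>auto simp: N_def\<close>)
    moreover have "N * ((N - 1) * (N + 1)) = 0"
      using that by (simp add: power3_eq_cube algebra_simps)
    then have "N = 0 \<or> N = 1 \<or> N = - 1" by auto
    ultimately show False using nonconst by auto
  qed
  have "N \<noteq> 0" "N \<noteq> 1" "N \<noteq> - 1" using not_root by auto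
  then have N: "0 < N" "N < 1"
    using cube_le_self_imp[of N] crit(2) bound[of x0] unfolding N_def by linarith+
  then have N0: "0 \<le> N" by simp
  let ?T = "quarter_period N"
  \<comment> \<open>This shift moves the maximum of the wave, at time \<open>?T\<close>, to \<open>x0\<close>.\<close>
  define a where "a = \<kappa> * ?T - x0"
  have "allen_cahn_solution (1 / (1 / \<kappa>)) (\<lambda>x. wave N (1 / \<kappa> * x + a / \<kappa>))"
    using \<open>\<kappa> \<noteq> 0\<close> by (intro allen_cahn_solution_affine allen_cahn_solution_wave N0 N) auto
  then have sol_w: "allen_cahn_solution \<kappa> (\<lambda>x. wave N ((x + a) / \<kappa>))"
    by (simp add: add_divide_distrib)
  have at_x0: "(x0 + a) / \<kappa> = ?T"
    using \<open>\<kappa> \<noteq> 0\<close> by (simp add: a_def)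
  have "((\<lambda>x. wave N ((x + a) / \<kappa>)) has_real_derivative 0) (at x0)"
    using at_x0 wave_velocity_quarter[OF N0 N(2)]
      DERIV_affine[OF wave_has_derivative[OF N0 N(2)], of "1 / \<kappa>" "a / \<kappa>" x0]
    by (simp add: add_divide_distrib)
  then have deriv_w: "deriv (\<lambda>x. wave N ((x + a) / \<kappa>)) x0 = 0"
    by (rule DERIV_imp_deriv)
  have u_eq: "u = (\<lambda>x. wave N ((x + a) / \<kappa>))"
  proof (rule solution_unique[OF sol sol_w \<open>\<kappa> \<noteq> 0\<close> bound, of x0])
    show "\<bar>wave N ((x + a) / \<kappa>)\<bar> \<le> 1" for x
      using abs_wave_le[OF N0 N(2), of "(x + a) / \<kappa>"] N(2) by linarith
    show "u x0 = wave N ((x0 + a) / \<kappa>)"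
      unfolding at_x0 wave_quarter[OF N0 N(2)] by (rule N_def[symmetric])
    show "deriv u x0 = deriv (\<lambda>x. wave N ((x + a) / \<kappa>)) x0"
      unfolding deriv_w crit ..
  qed
  have "wave N (t + 2 * pi / \<kappa>) = wave N t" for t
  proof -
    have "u (\<kappa> * t - a + 2 * pi) = u (\<kappa> * t - a)"
      using per by (simp add: periodic_2pi_def)
    then show ?thesis
      using \<open>\<kappa> \<noteq> 0\<close> unfolding u_eq by (simp add: add_divide_distrib add.commute)
  qed
  then obtain k :: int where k: "2 * pi / \<kappa> = 4 * of_int k * ?T"
    using wave_period_multiple[OF N0 N(2) N(1)] by blast
  have T: "0 < ?T" by (rule quarter_period_pos[OF N0 N(2)])
  have "0 < 2 * pi / \<kappa>" using \<open>0 < \<kappa>\<close> by simp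
  then have "0 < real_of_int k" unfolding k using T by (simp add: zero_less_mult_iff)
  then have "1 \<le> nat k" "of_nat (nat k) = real_of_int k" by auto
  moreover have "?T = pi / (2 * (real_of_int k * \<kappa>))"
    using k \<open>0 < real_of_int k\<close> \<open>0 < \<kappa>\<close> by (simp add: field_simps)
  ultimately show ?thesis
    using that[of N "nat k" a] N u_eq by simp
qed

section \<open>The ground state\<close>

lemma ground_state_max_eqI:
  assumes "0 < N" "N < 1" "quarter_period N = pi / (2 * \<kappa>)"
  shows "ground_state_max \<kappa> = N"
  unfolding ground_state_max_def
proof (rule the_equality)
  show N: "0 < N \<and> N < 1 \<and>
      (LINT \<theta>:{0..pi/2}|lebesgue. 1 / sqrt (2 - N\<^sup>2 * (1 + (sin \<theta>)\<^sup>2))) = pi / (2 * sqrt 2 * \<kappa>)"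
    using assms by (simp add: set_integral_quarter_period)
  fix M
  assume M: "0 < M \<and> M < 1 \<and>
      (LINT \<theta>:{0..pi/2}|lebesgue. 1 / sqrt (2 - M\<^sup>2 * (1 + (sin \<theta>)\<^sup>2))) = pi / (2 * sqrt 2 * \<kappa>)"
  have "quarter_period M / sqrt 2 = pi / (2 * sqrt 2 * \<kappa>)"
    by (subst set_integral_quarter_period[symmetric]) (use M in \<open>blast intro: less_imp_le\<close>)+
  moreover have "quarter_period N / sqrt 2 = pi / (2 * sqrt 2 * \<kappa>)"
    by (subst set_integral_quarter_period[symmetric]) (use N in \<open>blast intro: less_imp_le\<close>)+
  ultimately have "quarter_period M / sqrt 2 = quarter_period N / sqrt 2" by (rule trans[OF _ sym])
  then have eq: "quarter_period M = quarter_period N" by simp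
  have "0 \<le> M" "M < 1" "0 \<le> N" "N < 1" using M N by (blast intro: less_imp_le)+
  then show "M = N" by (rule quarter_period_inj[OF _ _ _ _ eq])
qed

lemma ground_state_max:
  assumes "0 < \<kappa>" "\<kappa> < 1"
  shows "0 < ground_state_max \<kappa>" "ground_state_max \<kappa> < 1"
    "quarter_period (ground_state_max \<kappa>) = pi / (2 * \<kappa>)"
proof -
  have "pi / 2 < pi / (2 * \<kappa>)"
    using assms by (intro divide_strict_left_mono) auto
  then obtain N where N: "0 < N" "N < 1" "quarter_period N = pi / (2 * \<kappa>)"
    using quarter_period_surj by blast
  then show "0 < ground_state_max \<kappa>" "ground_state_max \<kappa> < 1"
    "quarter_period (ground_state_max \<kappa>) = pi / (2 * \<kappa>)"
    using ground_state_max_eqI[OF N] by auto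
qed

text \<open>All derivatives of a solution \<open>u\<close> are polynomials in \<open>u\<close> and \<open>v = u'\<close>, because the equation expresses
\<open>v'\<close> as such a polynomial. Closure of this class under differentiation is smoothness.\<close>

inductive_set polynomials_in :: "(real \<Rightarrow> real) \<Rightarrow> (real \<Rightarrow> real) \<Rightarrow> (real \<Rightarrow> real) set"
  for u v where
  const: "(\<lambda>x. c) \<in> polynomials_in u v"
| fst: "u \<in> polynomials_in u v"
| snd: "v \<in> polynomials_in u v"
| add: "f \<in> polynomials_in u v \<Longrightarrow> g \<in> polynomials_in u v \<Longrightarrow> (\<lambda>x. f x + g x) \<in> polynomials_in u v"
| mult: "f \<in> polynomials_in u v \<Longrightarrow> g \<in> polynomials_in u v \<Longrightarrow> (\<lambda>x. f x * g x) \<in> polynomials_in u v"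

lemma polynomials_in_derivative:
  assumes u: "\<And>x. (u has_real_derivative u' x) (at x)" "u' \<in> polynomials_in u v"
    and v: "\<And>x. (v has_real_derivative v' x) (at x)" "v' \<in> polynomials_in u v"
    and f: "f \<in> polynomials_in u v"
  shows "\<exists>f'\<in>polynomials_in u v. \<forall>x. (f has_real_derivative f' x) (at x)"
  using f
proof induction
  case (const c)
  show ?case by (rule bexI[of _ "\<lambda>x. 0"]) (auto intro: polynomials_in.const)
next
  case (add f g)
  then obtain f' g' where "f' \<in> polynomials_in u v" "\<forall>x. (f has_real_derivative f' x) (at x)"
    "g' \<in> polynomials_in u v" "\<forall>x. (g has_real_derivative g' x) (at x)" by blast
  then show ?case
    by (intro bexI[of _ "\<lambda>x. f' x + g' x"])
      (auto intro!: derivative_eq_intros polynomials_in.add)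
next
  case (mult f g)
  then obtain f' g' where "f' \<in> polynomials_in u v" "\<forall>x. (f has_real_derivative f' x) (at x)"
    "g' \<in> polynomials_in u v" "\<forall>x. (g has_real_derivative g' x) (at x)" by blast
  with mult show ?case
    by (intro bexI[of _ "\<lambda>x. f' x * g x + f x * g' x"])
      (auto intro!: derivative_eq_intros polynomials_in.add polynomials_in.mult)
qed (use u v in auto)

lemma smooth_solution:
  assumes "allen_cahn_solution \<kappa> u" "\<kappa> \<noteq> 0"
  shows "smooth u"
proof -
  obtain v where v: "\<And>x. (u has_real_derivative v x) (at x)"
    "\<And>x. (v has_real_derivative ((u x) ^ 3 - u x) / \<kappa>\<^sup>2) (at x)"
    using allen_cahn_solutionE[OF assms] by blast
  let ?P = "polynomials_in u v"
  have "(\<lambda>x. (1 / \<kappa>\<^sup>2) * (u x * (u x * u x) + (- 1) * u x)) \<in> ?P"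
    by (intro polynomials_in.intros)
  also have "(\<lambda>x. (1 / \<kappa>\<^sup>2) * (u x * (u x * u x) + (- 1) * u x)) = (\<lambda>x. ((u x) ^ 3 - u x) / \<kappa>\<^sup>2)"
    by (simp add: power3_eq_cube mult.assoc)
  finally have step: "\<exists>f'\<in>?P. \<forall>x. (f has_real_derivative f' x) (at x)" if "f \<in> ?P" for f
    using polynomials_in_derivative[OF v(1) polynomials_in.snd v(2) _ that] by blast
  have iter: "(deriv ^^ n) u \<in> ?P" for n
  proof (induction n)
    case (Suc n)
    then obtain f' where f': "f' \<in> ?P" "\<forall>x. ((deriv ^^ n) u has_real_derivative f' x) (at x)"
      using step by blast
    then have "deriv ((deriv ^^ n) u) = f'" by (auto simp: DERIV_imp_deriv)
    then show ?case using f' by simp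
  qed (simp add: polynomials_in.fst)
  show ?thesis
    unfolding smooth_def field_differentiable_def using step[OF iter] by blast
qed

text \<open>The relation between \<open>N\<close> and \<open>\<kappa>\<close> puts the quarter period of the rescaled wave at \<open>\<pi> / 2\<close>. Amplitude
0 is allowed and belongs to \<open>\<kappa> = 1\<close>, so the zero solution is the endpoint of the family.\<close>

lemma scaled_wave:
  assumes "0 < \<kappa>" and N: "0 \<le> N" "N < 1" "quarter_period N = pi / (2 * \<kappa>)"
  shows scaled_wave_solution: "allen_cahn_solution \<kappa> (\<lambda>x. wave N (x / \<kappa>))"
    and scaled_wave_odd: "wave N (- x / \<kappa>) = - wave N (x / \<kappa>)"
    and scaled_wave_reflect: "wave N ((pi - x) / \<kappa>) = wave N (x / \<kappa>)"
    and scaled_wave_periodic: "periodic_2pi (\<lambda>x. wave N (x / \<kappa>))"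
proof -
  have "\<kappa> \<noteq> 0" using assms by simp
  have "allen_cahn_solution (1 / (1 / \<kappa>)) (\<lambda>x. wave N (1 / \<kappa> * x + 0))"
    using \<open>\<kappa> \<noteq> 0\<close> N by (intro allen_cahn_solution_affine allen_cahn_solution_wave) auto
  then show "allen_cahn_solution \<kappa> (\<lambda>x. wave N (x / \<kappa>))" by simp
  show odd: "wave N (- x / \<kappa>) = - wave N (x / \<kappa>)" for x
    using wave_minus[OF N(1,2)] by simp
  show reflect: "wave N ((pi - x) / \<kappa>) = wave N (x / \<kappa>)" for x
    using wave_reflect[OF N(1,2), of "x / \<kappa>"] \<open>\<kappa> \<noteq> 0\<close>
    by (simp add: N diff_divide_distrib)
  have "wave N ((x + 2 * pi) / \<kappa>) = wave N (x / \<kappa>)" for x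
    using reflect[of "x + 2 * pi"] reflect[of "- x"] odd[of "x + pi"] odd[of x]
    by (simp add: algebra_simps)
  then show "periodic_2pi (\<lambda>x. wave N (x / \<kappa>))" by (simp add: periodic_2pi_def)
qed

text \<open>The rescaled wave has all the defining properties, and any other candidate is a periodic solution with
the same Cauchy data at \<open>\<pi> / 2\<close>, so uniqueness for the initial value problem applies.\<close>

lemma ground_state_eq:
  assumes "0 < \<kappa>" "\<kappa> < 1"
  shows "ground_state \<kappa> = (\<lambda>x. wave (ground_state_max \<kappa>) (x / \<kappa>))"
proof -
  define N where "N = ground_state_max \<kappa>"
  define U where "U x = wave N (x / \<kappa>)" for x
  have N: "0 \<le> N" "N < 1" "quarter_period N = pi / (2 * \<kappa>)"
    using ground_state_max[OF assms] by (auto simp: N_def)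
  have "\<kappa> \<noteq> 0" using assms by simp
  note U = scaled_wave[OF assms(1) N, folded U_def]
  have dU: "(U has_real_derivative wave_velocity N (x / \<kappa>) / \<kappa>) (at x)" for x
    unfolding U_def[abs_def]
    using DERIV_affine[OF wave_has_derivative[OF N(1,2)], of "1 / \<kappa>" 0] by simp
  have crit: "deriv U (pi / 2) = 0" "U (pi / 2) = N"
    using wave_velocity_quarter[OF N(1,2)] wave_quarter[OF N(1,2)] N
    by (auto simp: DERIV_imp_deriv[OF dU] U_def mult.commute)
  have mono: "mono_on {0..pi/2} U"
  proof (rule mono_onI)
    fix x y assume "x \<in> {0..pi/2}" "y \<in> {0..pi/2}" "x \<le> y"
    then show "U x \<le> U y"
      unfolding U_def using assms N by (intro wave_mono) (auto simp: field_simps)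
  qed
  have "ground_state \<kappa> = U"
    unfolding ground_state_def N_def[symmetric]
  proof (rule the_equality)
    show "periodic_2pi U \<and> (\<forall>x. U (- x) = - U x) \<and> smooth U \<and> allen_cahn_solution \<kappa> U \<and>
      U 0 = 0 \<and> deriv U (pi/2) = 0 \<and> U (pi/2) = N \<and>
      mono_on {0..pi/2} U \<and> (\<forall>x\<in>{pi/2..pi}. U (pi - x) = U x)"
      using U smooth_solution[OF U(1) \<open>\<kappa> \<noteq> 0\<close>] crit mono U(2)[of 0] by auto
    fix W
    assume "periodic_2pi W \<and> (\<forall>x. W (- x) = - W x) \<and> smooth W \<and> allen_cahn_solution \<kappa> W \<and>
      W 0 = 0 \<and> deriv W (pi/2) = 0 \<and> W (pi/2) = N \<and>
      mono_on {0..pi/2} W \<and> (\<forall>x\<in>{pi/2..pi}. W (pi - x) = W x)"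
    then have W: "periodic_2pi W" "allen_cahn_solution \<kappa> W" "deriv W (pi / 2) = 0" "W (pi / 2) = N"
      by auto
    show "W = U"
      by (rule solution_unique[OF W(2) U(1) \<open>\<kappa> \<noteq> 0\<close>, of "pi / 2"])
        (use W crit periodic_solution_bounded[OF W(2) \<open>\<kappa> \<noteq> 0\<close> W(1)]
          periodic_solution_bounded[OF U(1) \<open>\<kappa> \<noteq> 0\<close> U(4)] in auto)
  qed
  then show ?thesis
    by (simp add: U_def[abs_def] N_def)
qed

section \<open>Membership in the Sobolev class and the energy\<close>

lemma square_integrable_torus_continuous:
  assumes "continuous_on UNIV g"
  shows "square_integrable_torus g"
proof -
  have c: "continuous_on {-pi..pi} g" "continuous_on {-pi..pi} (\<lambda>x. (g x)\<^sup>2)"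
    using assms by (auto intro!: continuous_intros intro: continuous_on_subset)
  show ?thesis
    unfolding square_integrable_torus_def torus_def
    using absolutely_integrable_continuous_real[OF c(1)] absolutely_integrable_continuous_real[OF c(2)]
    by (auto simp: set_integrable_def set_borel_measurable_def)
qed

lemma torus_integral_FTC:
  assumes "continuous_on UNIV f" "\<And>x. (F has_real_derivative f x) (at x)"
  shows "(LINT x:torus|lebesgue. f x) = F pi - F (- pi)"
  unfolding torus_def
  by (rule set_lebesgue_integral_FTC) (use assms in \<open>auto intro: continuous_on_subset\<close>)

lemma periodic_2pi_at_minus_pi:
  assumes "periodic_2pi u"
  shows "u (- pi) = u pi"
  using assms[unfolded periodic_2pi_def, rule_format, of "- pi"] by simp

lemma periodic_2pi_derivative:
  assumes "periodic_2pi u" and u: "\<And>x. (u has_real_derivative v x) (at x)"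
  shows "periodic_2pi v"
  unfolding periodic_2pi_def
proof
  fix x
  have "((\<lambda>x. u (1 * x + 2 * pi)) has_real_derivative 1 * v (1 * x + 2 * pi)) (at x)"
    by (rule DERIV_affine[OF u])
  then have "(u has_real_derivative v (x + 2 * pi)) (at x)"
    using assms(1) by (simp add: periodic_2pi_def)
  then show "v (x + 2 * pi) = v x" using u DERIV_unique by blast
qed

text \<open>Integration by parts: the boundary terms at \<open>-\<pi>\<close> and \<open>\<pi>\<close> cancel by periodicity.\<close>

lemma weak_derivative_torus_derivative:
  assumes per: "periodic_2pi u" and u: "\<And>x. (u has_real_derivative v x) (at x)"
    and v: "continuous_on UNIV v"
  shows "weak_derivative_torus u v"
  unfolding weak_derivative_torus_def
proof (intro allI impI, elim conjE)
  fix \<psi> assume smooth: "smooth \<psi>" and \<psi>_per: "periodic_2pi \<psi>"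
  have diff: "(deriv ^^ n) \<psi> field_differentiable at x" for n x
    using smooth by (simp add: smooth_def)
  have \<psi>: "(\<psi> has_real_derivative deriv \<psi> x) (at x)" for x
    using diff[of 0 x] by (simp add: DERIV_deriv_iff_field_differentiable)
  have \<psi>': "continuous_on UNIV (deriv \<psi>)"
    using diff[of 1] by (auto intro!: continuous_at_imp_continuous_on field_differentiable_imp_continuous_at)
  have cont: "continuous_on UNIV u" "continuous_on UNIV \<psi>"
    by (rule has_real_derivative_imp_continuous_on, rule u \<psi>)+
  obtain F where F: "\<And>x. (F has_real_derivative u x * deriv \<psi> x) (at x)"
    using primitive_exists[of "\<lambda>x. u x * deriv \<psi> x"] cont \<psi>' by (auto intro!: continuous_intros)
  have "((\<lambda>x. u x * \<psi> x - F x) has_real_derivative v x * \<psi> x) (at x)" for x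
    by (auto intro!: derivative_eq_intros u \<psi> F)
  then have "(LINT x:torus|lebesgue. v x * \<psi> x)
      = (u pi * \<psi> pi - F pi) - (u (- pi) * \<psi> (- pi) - F (- pi))"
    using cont v by (intro torus_integral_FTC continuous_intros)
  moreover have "(LINT x:torus|lebesgue. u x * deriv \<psi> x) = F pi - F (- pi)"
    using cont \<psi>' F by (intro torus_integral_FTC continuous_intros)
  ultimately show "(LINT x:torus|lebesgue. u x * deriv \<psi> x) = - (LINT x:torus|lebesgue. v x * \<psi> x)"
    by (simp add: periodic_2pi_at_minus_pi[OF per] periodic_2pi_at_minus_pi[OF \<psi>_per])
qed

lemma solution_in_solutions:
  assumes "\<kappa> \<noteq> 0" and sol: "allen_cahn_solution \<kappa> u" and per: "periodic_2pi u"
    and bound: "\<And>x. \<bar>u x\<bar> < 1"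
  shows "u \<in> solutions \<kappa>"
proof -
  obtain v where v: "\<And>x. (u has_real_derivative v x) (at x)"
    "\<And>x. (v has_real_derivative ((u x) ^ 3 - u x) / \<kappa>\<^sup>2) (at x)"
    using allen_cahn_solutionE[OF sol \<open>\<kappa> \<noteq> 0\<close>] by blast
  have "continuous_on UNIV v" by (rule has_real_derivative_imp_continuous_on[OF v(2)])
  then have "u \<in> H1_torus"
    unfolding H1_torus_def
    using per solution_continuous[OF sol] weak_derivative_torus_derivative[OF per v(1)]
      square_integrable_torus_continuous by blast
  then show ?thesis
    using assms by (simp add: solutions_def)
qed

text \<open>By the equation, \<open>(\<kappa>\<^sup>2 / 2) (u u')' = (\<kappa>\<^sup>2 / 2) u'\<^sup>2 + (u\<^sup>4 - u\<^sup>2) / 2\<close>, so the energy density differs from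
\<open>(1 - u\<^sup>4) / 4\<close> by the derivative of a periodic function. A primitive \<open>F\<close> stands for the integral,
which makes shifts, reflections and rescalings of the domain purely algebraic later on.\<close>

lemma energy_of_solution:
  assumes "\<kappa> \<noteq> 0" and sol: "allen_cahn_solution \<kappa> u" and per: "periodic_2pi u"
    and F: "\<And>x. (F has_real_derivative 1 - (u x) ^ 4) (at x)"
  shows "energy \<kappa> u = (F pi - F (- pi)) / 4"
proof -
  obtain v where v: "\<And>x. (u has_real_derivative v x) (at x)"
    "\<And>x. (v has_real_derivative ((u x) ^ 3 - u x) / \<kappa>\<^sup>2) (at x)"
    using allen_cahn_solutionE[OF sol \<open>\<kappa> \<noteq> 0\<close>] by blast
  let ?G = "\<lambda>x. F x / 4 + \<kappa>\<^sup>2 / 2 * (u x * v x)"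
  let ?e = "\<lambda>x. \<kappa>\<^sup>2 / 2 * \<bar>deriv u x\<bar>\<^sup>2 + 1 / 4 * (1 - (u x)\<^sup>2)\<^sup>2"
  have e: "?e = (\<lambda>x. \<kappa>\<^sup>2 / 2 * (v x)\<^sup>2 + 1 / 4 * (1 - (u x)\<^sup>2)\<^sup>2)"
    by (simp add: DERIV_imp_deriv[OF v(1)])
  have "(?G has_real_derivative
      (1 - (u x) ^ 4) / 4 + \<kappa>\<^sup>2 / 2 * (v x * v x + ((u x) ^ 3 - u x) / \<kappa>\<^sup>2 * u x)) (at x)" for x
    by (intro DERIV_add DERIV_cdivide DERIV_cmult DERIV_mult F v)
  moreover have "(1 - (u x) ^ 4) / 4 + \<kappa>\<^sup>2 / 2 * (v x * v x + ((u x) ^ 3 - u x) / \<kappa>\<^sup>2 * u x) = ?e x" for x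
    using \<open>\<kappa> \<noteq> 0\<close> unfolding DERIV_imp_deriv[OF v(1)] by (simp add: field_simps power2_eq_square power3_eq_cube power4_eq_xxxx)
  ultimately have G: "(?G has_real_derivative ?e x) (at x)" for x
    by (rule DERIV_cong)
  have "continuous_on UNIV ?e"
    unfolding e using has_real_derivative_imp_continuous_on[OF v(1)]
      has_real_derivative_imp_continuous_on[OF v(2)] by (intro continuous_intros) auto
  from torus_integral_FTC[OF this G] show ?thesis
    unfolding energy_def
    using periodic_2pi_at_minus_pi[OF per]
      periodic_2pi_at_minus_pi[OF periodic_2pi_derivative[OF per v(1)]]
    by (simp add: diff_divide_distrib)
qed

lemma quartic_primitive:
  assumes "allen_cahn_solution \<kappa> u"
  obtains F where "\<And>x. (F has_real_derivative 1 - (u x) ^ 4) (at x)"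
proof -
  have "continuous_on UNIV (\<lambda>x. 1 - (u x) ^ 4)"
    using solution_continuous[OF assms] by (intro continuous_intros)
  from primitive_exists[OF this] show ?thesis using that by blast
qed

lemma energy_zero: 
  assumes "\<kappa> \<noteq> 0"
  shows "energy \<kappa> (\<lambda>x. 0) = pi / 2"
  using energy_of_solution[OF assms allen_cahn_solution_const[of 0], of "\<lambda>x. x"]
  by (simp add: periodic_2pi_def)

text \<open>The increment of \<open>F\<close> over an interval of length \<open>2 \<pi>\<close> is the same everywhere; the rescaled function
sees \<open>j\<close> such increments, each divided by \<open>j\<close>.\<close>

lemma energy_rescaled:
  assumes "\<kappa> \<noteq> 0" "1 \<le> j" and sol: "allen_cahn_solution \<kappa> u" and per: "periodic_2pi u"
  shows "energy (\<kappa> / of_nat j) (\<lambda>x. u (of_nat j * x + b)) = energy \<kappa> u"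
proof -
  have j: "0 < real j" using \<open>1 \<le> j\<close> by simp
  obtain F where F: "\<And>x. (F has_real_derivative 1 - (u x) ^ 4) (at x)"
    using quartic_primitive[OF sol] by blast
  have period: "F (x + 2 * pi) - F x = F pi - F (- pi)" for x
    using derivative_shift_const[OF F, of "2 * pi" x "- pi"] per by (simp add: periodic_2pi_def)
  have periods: "F (x + of_nat n * (2 * pi)) = F x + of_nat n * (F pi - F (- pi))" for x n
  proof (induction n)
    case (Suc n)
    then show ?case
      using period[of "x + of_nat n * (2 * pi)"] by (simp add: algebra_simps)
  qed simp
  have w_per: "periodic_2pi (\<lambda>x. u (of_nat j * x + b))"
  proof -
    have "u (of_nat j * (x + 2 * pi) + b) = u (of_nat j * x + b)" for x
      using periodic_2pi_of_int[OF per, of "of_nat j * x + b" "int j"] by (simp add: algebra_simps)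
    then show ?thesis by (simp add: periodic_2pi_def)
  qed
  have "((\<lambda>x. F (of_nat j * x + b) / of_nat j) has_real_derivative
      of_nat j * (1 - (u (of_nat j * x + b)) ^ 4) / of_nat j) (at x)" for x
    by (intro DERIV_cdivide DERIV_affine[OF F])
  then have "((\<lambda>x. F (of_nat j * x + b) / of_nat j) has_real_derivative
      1 - (u (of_nat j * x + b)) ^ 4) (at x)" for x
    using j by simp
  then have "energy (\<kappa> / of_nat j) (\<lambda>x. u (of_nat j * x + b))
      = (F (of_nat j * pi + b) / of_nat j - F (of_nat j * (- pi) + b) / of_nat j) / 4"
    using j \<open>\<kappa> \<noteq> 0\<close> w_per
    by (intro energy_of_solution allen_cahn_solution_affine[OF sol]) auto
  also have "F (of_nat j * pi + b) = F (of_nat j * (- pi) + b) + of_nat j * (F pi - F (- pi))"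
    using periods[of "of_nat j * (- pi) + b" j] by (simp add: algebra_simps)
  also have "((F (of_nat j * (- pi) + b) + of_nat j * (F pi - F (- pi))) / of_nat j
      - F (of_nat j * (- pi) + b) / of_nat j) / 4 = (F pi - F (- pi)) / 4"
    using j by (simp add: field_simps)
  also have "\<dots> = energy \<kappa> u"
    by (rule energy_of_solution[OF \<open>\<kappa> \<noteq> 0\<close> sol per F, symmetric])
  finally show ?thesis .
qed

section \<open>Monotonicity of the energy\<close>

text \<open>Oddness about 0 and evenness about \<open>\<pi> / 2\<close> of the wave reduce the integral over the torus to four
times the integral over \<open>[0, \<pi> / 2]\<close>.\<close>

lemma energy_scaled_wave:
  assumes "0 < \<kappa>" and N: "0 \<le> N" "N < 1" "quarter_period N = pi / (2 * \<kappa>)"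
    and F: "\<And>x. (F has_real_derivative 1 - (wave N (x / \<kappa>)) ^ 4) (at x)"
  shows "energy \<kappa> (\<lambda>x. wave N (x / \<kappa>)) = F (pi / 2) - F 0"
proof -
  note U = scaled_wave[OF assms(1) N]
  have even: "F x + F (0 - x) = F 0 + F (0 - 0)" for x
    by (rule derivative_reflect_const[OF F]) (use scaled_wave_odd[OF assms(1) N] in simp)
  have reflect: "F x + F (pi - x) = F (pi / 2) + F (pi - pi / 2)" for x
    by (rule derivative_reflect_const[OF F]) (use scaled_wave_reflect[OF assms(1) N] in simp)
  have "energy \<kappa> (\<lambda>x. wave N (x / \<kappa>)) = (F pi - F (- pi)) / 4"
    using assms(1) U F by (intro energy_of_solution) auto
  then show ?thesis
    using even[of pi] reflect[of 0] by simp
qed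

text \<open>After squaring, with \<open>a \<le> b\<close> the halved squared amplitudes and \<open>p \<le> q\<close> the values of \<open>1 + sin\<^sup>2\<close>, the
difference of the two sides is \<open>(b - a) (q - p)\<close>.\<close>

lemma phase_speed_ratio_antimono:
  assumes M: "0 \<le> M" "M < N" "N < 1" and s: "0 \<le> x" "x \<le> y" "y \<le> pi / 2"
  shows "phase_speed N y * phase_speed M x \<le> phase_speed N x * phase_speed M y"
proof (rule power2_le_imp_le)
  have N: "0 \<le> N" "M < 1" using M by auto
  define a b where "a = M\<^sup>2 / 2" and "b = N\<^sup>2 / 2"
  define p q where "p = 1 + (sin x)\<^sup>2" and "q = 1 + (sin y)\<^sup>2"
  have "a \<le> b" unfolding a_def b_def using M by (simp add: power_mono)
  have "sin x \<le> sin y" "0 \<le> sin x"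
    using s by (auto intro!: sin_monotone_2pi_le sin_ge_zero)
  then have "p \<le> q" unfolding p_def q_def by (simp add: power_mono)
  have "0 \<le> (b - a) * (q - p)" using \<open>a \<le> b\<close> \<open>p \<le> q\<close> by simp
  then have "(1 - b * q) * (1 - a * p) \<le> (1 - b * p) * (1 - a * q)"
    by (simp add: algebra_simps)
  then show "(phase_speed N y * phase_speed M x)\<^sup>2 \<le> (phase_speed N x * phase_speed M y)\<^sup>2"
    unfolding power_mult_distrib phase_speed_square[OF N(1) M(3)] phase_speed_square[OF M(1) N(2)]
    by (simp add: a_def b_def p_def q_def)
  show "0 \<le> phase_speed N x * phase_speed M y"
    using phase_speed_pos[OF N(1) M(3)] phase_speed_pos[OF M(1) N(2)] by (simp add: less_imp_le)
qed

text \<open>The wave of larger amplitude is comparatively slow near its maximum, so it has used a smaller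
fraction of its quarter period when it reaches a given phase. The cross-multiplied difference
vanishes at both ends, and its derivative changes sign at most once, from positive to negative,
because the ratio of the phase speeds is monotone.\<close>

lemma phase_time_fraction_antimono:
  assumes M: "0 \<le> M" "M < N" "N < 1" and \<theta>: "0 \<le> \<theta>" "\<theta> \<le> pi / 2"
  shows "phase_time N \<theta> * quarter_period M \<le> phase_time M \<theta> * quarter_period N"
proof -
  have N: "0 \<le> N" "M < 1" using M by auto
  let ?S = "quarter_period M" and ?T = "quarter_period N"
  note pos = phase_speed_pos[OF N(1) M(3)] phase_speed_pos[OF M(1) N(2)]
  have "0 \<le> phase_time M \<theta> * ?T - phase_time N \<theta> * ?S"
  proof (rule above_chord_if_derivative_sign_changes[where a = 0 and b = "pi / 2" and z = \<theta>
        and f = "\<lambda>\<theta>. phase_time M \<theta> * ?T - phase_time N \<theta> * ?S"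
        and f' = "\<lambda>\<theta>. 1 / phase_speed M \<theta> * ?T - 1 / phase_speed N \<theta> * ?S"])
    show "((\<lambda>\<theta>. phase_time M \<theta> * ?T - phase_time N \<theta> * ?S) has_real_derivative
        1 / phase_speed M \<theta> * ?T - 1 / phase_speed N \<theta> * ?S) (at \<theta>)" for \<theta>
      using M N by (intro DERIV_diff DERIV_cmult_right phase_time_has_derivative)
    fix x y :: real
    assume xy: "0 < x" "x < y" "y < pi / 2" and "1 / phase_speed M x * ?T - 1 / phase_speed N x * ?S < 0"
    then have less: "?T * phase_speed N x < ?S * phase_speed M x"
      using pos[of x] by (simp add: field_simps)
    have "?T * phase_speed N y * phase_speed M x = ?T * (phase_speed N y * phase_speed M x)"
      by simp
    also have "\<dots> \<le> ?T * (phase_speed N x * phase_speed M y)"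
      using xy quarter_period_pos[OF N(1) M(3)]
      by (intro mult_left_mono phase_speed_ratio_antimono[OF M]) auto
    also have "\<dots> \<le> ?S * phase_speed M x * phase_speed M y"
      using mult_right_mono[OF less_imp_le[OF less] less_imp_le[OF pos(2)]] by (simp add: mult.assoc)
    finally have "(?T * phase_speed N y) * phase_speed M x \<le> (?S * phase_speed M y) * phase_speed M x"
      by (simp add: mult_ac)
    then have "?T * phase_speed N y \<le> ?S * phase_speed M y"
      using pos(2)[of x] by (simp only: mult_le_cancel_right_pos)
    then show "1 / phase_speed M y * ?T - 1 / phase_speed N y * ?S \<le> 0"
      using pos[of y] by (simp add: field_simps)
  qed (use M N \<theta> in \<open>auto simp: phase_time_0 quarter_period_def[symmetric]\<close>)
  then show ?thesis by simp
qed

text \<open>At equal fractions of the quarter period the larger amplitude comes with the larger phase.\<close>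

lemma wave_less_at_same_fraction:
  assumes M: "0 \<le> M" "M < N" "N < 1" and s: "0 < s" "s \<le> 1"
  shows "wave M (s * quarter_period M) < wave N (s * quarter_period N)"
proof -
  have N: "0 \<le> N" "M < 1" using M by auto
  let ?S = "quarter_period M" and ?T = "quarter_period N"
  define \<phi> \<psi> where "\<phi> = phase M (s * ?S)" and "\<psi> = phase N (s * ?T)"
  have pos: "0 < ?S" "0 < ?T"
    using quarter_period_pos M N by auto
  then have "0 \<le> s * ?S" "s * ?S \<le> ?S" "0 \<le> s * ?T" "s * ?T \<le> ?T"
    using s by (auto intro!: mult_left_le_one_le)
  then have range: "0 \<le> \<phi>" "\<phi> \<le> pi / 2" "\<psi> \<le> pi / 2"
    unfolding \<phi>_def \<psi>_def using M N by (blast intro: phase_quarter_bounds)+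
  have "\<phi> \<noteq> 0"
    unfolding \<phi>_def using pos s by (auto simp: phase_eq_iff[OF M(1) N(2)] phase_time_0[OF M(1) N(2)])
  then have "0 < sin \<phi>" using range by (intro sin_gt_zero) auto
  have "phase_time N \<phi> * ?S \<le> phase_time M \<phi> * ?T"
    using range by (intro phase_time_fraction_antimono[OF M])
  also have "\<dots> = (s * ?T) * ?S"
    unfolding \<phi>_def by (simp add: phase_time_phase[OF M(1) N(2)])
  finally have "phase_time N \<phi> \<le> s * ?T" using pos by simp
  then have "\<phi> \<le> \<psi>"
    unfolding \<psi>_def by (simp add: phase_ge_iff[OF N(1) M(3)])
  then have "sin \<phi> \<le> sin \<psi>"
    using range by (intro sin_monotone_2pi_le) auto
  have "M * sin \<phi> < N * sin \<phi>" using M \<open>0 < sin \<phi>\<close> by simp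
  also have "\<dots> \<le> N * sin \<psi>" using N \<open>sin \<phi> \<le> sin \<psi>\<close> by (simp add: mult_left_mono)
  finally show ?thesis by (simp add: wave_def \<phi>_def \<psi>_def)
qed

text \<open>On \<open>(0, \<pi> / 2)\<close> the wave for \<open>\<kappa>\<close> lies strictly above the one for \<open>\<mu>\<close>, hence has the smaller integral of
\<open>1 - u\<^sup>4\<close>.\<close>

lemma energy_scaled_wave_strict_mono:
  assumes "0 < \<kappa>" "\<kappa> < \<mu>"
    and N: "0 \<le> N" "N < 1" "quarter_period N = pi / (2 * \<kappa>)"
    and M: "0 \<le> M" "M < 1" "quarter_period M = pi / (2 * \<mu>)"
  shows "energy \<kappa> (\<lambda>x. wave N (x / \<kappa>)) < energy \<mu> (\<lambda>x. wave M (x / \<mu>))"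
proof -
  have "0 < \<mu>" using assms by simp
  have "quarter_period M < quarter_period N"
    unfolding N M using assms by (intro divide_strict_left_mono) auto
  then have "M < N"
    using quarter_period_strict_mono[of N M] N M by (cases M N rule: linorder_cases) auto
  obtain F where F: "\<And>x. (F has_real_derivative 1 - (wave N (x / \<kappa>)) ^ 4) (at x)"
    using quartic_primitive[OF scaled_wave_solution[OF assms(1) N]] by blast
  obtain G where G: "\<And>x. (G has_real_derivative 1 - (wave M (x / \<mu>)) ^ 4) (at x)"
    using quartic_primitive[OF scaled_wave_solution[OF \<open>0 < \<mu>\<close> M]] by blast
  have "G 0 - F 0 < G (pi / 2) - F (pi / 2)"
  proof (rule DERIV_pos_imp_increasing_open[where f = "\<lambda>x. G x - F x"])
    fix x assume x: "0 < x" "x < pi / 2"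
    define s where "s = x / (pi / 2)"
    have s: "0 < s" "s \<le> 1" "s * quarter_period N = x / \<kappa>" "s * quarter_period M = x / \<mu>"
      using x unfolding N M s_def by auto
    have "wave M (x / \<mu>) < wave N (x / \<kappa>)"
      using wave_less_at_same_fraction[OF M(1) \<open>M < N\<close> N(2) s(1,2)] by (simp add: s)
    moreover have "0 \<le> wave M (x / \<mu>)"
      using wave_mono[OF M(1,2), of 0 "x / \<mu>"] wave_0[OF M(1,2)] x \<open>0 < \<mu>\<close> M
      by (simp add: field_simps)
    ultimately have "(wave M (x / \<mu>)) ^ 4 < (wave N (x / \<kappa>)) ^ 4"
      by (intro power_strict_mono) auto
    then show "\<exists>y. ((\<lambda>x. G x - F x) has_real_derivative y) (at x) \<and> 0 < y"
      by (intro exI[of _ "(1 - (wave M (x / \<mu>)) ^ 4) - (1 - (wave N (x / \<kappa>)) ^ 4)"] conjI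
          DERIV_diff F G) simp
  next
    show "continuous_on {0..pi / 2} (\<lambda>x. G x - F x)"
      using has_real_derivative_imp_continuous_on[OF F] has_real_derivative_imp_continuous_on[OF G]
      by (intro continuous_intros)
  qed simp
  then show ?thesis
    using energy_scaled_wave[OF assms(1) N F] energy_scaled_wave[OF \<open>0 < \<mu>\<close> M G] by simp
qed

section \<open>Closeness to the heteroclinic profile\<close>

text \<open>With \<open>q\<^sup>2 = 1 - N\<^sup>2\<close> the squared phase speed is \<open>(cos\<^sup>2 \<theta> + q\<^sup>2 (1 + sin\<^sup>2 \<theta>)) / 2\<close>, which is at least
\<open>((cos \<theta> + q) / 2)\<^sup>2\<close>; replacing the cosine by its chord gives a bound whose reciprocal has an
elementary primitive.\<close>

lemma phase_speed_lower_bound: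
  assumes N: "0 \<le> N" "N < 1" and \<theta>: "0 \<le> \<theta>" "\<theta> \<le> pi / 2"
  shows "(1 - 2 / pi * \<theta> + sqrt (1 - N\<^sup>2)) / 2 \<le> phase_speed N \<theta>"
proof (rule power2_le_imp_le)
  let ?q = "sqrt (1 - N\<^sup>2)"
  have q: "0 \<le> ?q" "?q\<^sup>2 = 1 - N\<^sup>2"
    using N_square_less_1[OF N] by auto
  have c: "0 \<le> cos \<theta>" using \<theta> by (intro cos_ge_zero) auto
  have lin: "0 \<le> 1 - 2 / pi * \<theta>" using \<theta> by (simp add: field_simps)
  have "((1 - 2 / pi * \<theta> + ?q) / 2)\<^sup>2 \<le> ((cos \<theta> + ?q) / 2)\<^sup>2"
    using cos_above_chord[OF \<theta>] q lin by (intro power_mono) auto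
  also have "\<dots> \<le> ((cos \<theta>)\<^sup>2 + ?q\<^sup>2) / 2"
    using zero_le_power2[of "cos \<theta> - ?q"] by (simp add: power2_eq_square field_simps)
  also have "\<dots> \<le> ((cos \<theta>)\<^sup>2 + ?q\<^sup>2 * (1 + (sin \<theta>)\<^sup>2)) / 2"
    by (simp add: algebra_simps)
  also have "\<dots> = (phase_speed N \<theta>)\<^sup>2"
    unfolding phase_speed_square[OF N] q cos_squared_eq by (simp add: field_simps)
  finally show "((1 - 2 / pi * \<theta> + ?q) / 2)\<^sup>2 \<le> (phase_speed N \<theta>)\<^sup>2" .
  show "0 \<le> phase_speed N \<theta>" using phase_speed_pos[OF N] by (simp add: less_imp_le)
qed

lemma quarter_period_upper_bound:
  assumes N: "0 \<le> N" "N < 1"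
  shows "quarter_period N \<le> pi * ln ((1 + sqrt (1 - N\<^sup>2)) / sqrt (1 - N\<^sup>2))"
proof -
  let ?q = "sqrt (1 - N\<^sup>2)"
  have q: "0 < ?q" using N_square_less_1[OF N] by simp
  let ?f = "\<lambda>\<theta>. phase_time N \<theta> + pi * ln (1 - 2 / pi * \<theta> + ?q)"
  have "?f (pi / 2) \<le> ?f 0"
  proof (rule DERIV_nonpos_imp_nonincreasing[where f = ?f])
    fix \<theta> assume \<theta>: "0 \<le> \<theta>" "\<theta> \<le> pi / 2"
    have "0 \<le> 1 - 2 / pi * \<theta>" using \<theta> by (simp add: field_simps)
    then have d: "0 < 1 - 2 / pi * \<theta> + ?q" using q by linarith
    have "(?f has_real_derivative 1 / phase_speed N \<theta> - 2 / (1 - 2 / pi * \<theta> + ?q)) (at \<theta>)"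
      using d by (auto intro!: derivative_eq_intros phase_time_has_derivative[OF N])
    moreover have "1 / phase_speed N \<theta> \<le> 1 / ((1 - 2 / pi * \<theta> + ?q) / 2)"
      using phase_speed_lower_bound[OF N \<theta>] d by (intro divide_left_mono) (auto intro!: mult_pos_pos phase_speed_pos N)
    ultimately show "\<exists>y. (?f has_real_derivative y) (at \<theta>) \<and> y \<le> 0"
      by (intro exI[of _ "1 / phase_speed N \<theta> - 2 / (1 - 2 / pi * \<theta> + ?q)"]) simp
  qed simp
  then have "quarter_period N + pi * ln ?q \<le> pi * ln (1 + ?q)"
    using phase_time_0[OF N] by (simp add: quarter_period_def)
  moreover have "ln ((1 + ?q) / ?q) = ln (1 + ?q) - ln ?q"
    using q by (intro ln_divide_pos) linarith+
  ultimately show ?thesis by (simp add: right_diff_distrib)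
qed

text \<open>Inverting the logarithmic bound gives \<open>q (E - 1) \<le> 1\<close> for \<open>q = sqrt (1 - N\<^sup>2)\<close> and
\<open>E = exp (T / \<pi>)\<close>, \<open>T\<close> being the quarter period. As \<open>T \<ge> \<pi> / 2\<close>, the term \<open>E\<close> is at least
\<open>3 / 2\<close>, so \<open>E - 1 \<ge> E / 3\<close> and \<open>q \<le> 3 / E\<close>.\<close>

lemma amplitude_deficit_exponentially_small:
  assumes N: "0 \<le> N" "N < 1"
  shows "1 - N\<^sup>2 \<le> 9 * exp (- 2 * quarter_period N / pi)"
proof -
  let ?q = "sqrt (1 - N\<^sup>2)" and ?E = "exp (quarter_period N / pi)"
  have q: "0 < ?q" "?q\<^sup>2 = 1 - N\<^sup>2" using N_square_less_1[OF N] by auto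
  have "quarter_period N / pi \<le> ln ((1 + ?q) / ?q)"
    using quarter_period_upper_bound[OF N] by (simp add: field_simps)
  then have "?E \<le> exp (ln ((1 + ?q) / ?q))" by (simp only: exp_le_cancel_iff)
  also have "\<dots> = (1 + ?q) / ?q" using q by (intro exp_ln divide_pos_pos) linarith+
  finally have "?E \<le> (1 + ?q) / ?q" .
  then have upper: "?E * ?q \<le> 1 + ?q" using q by (simp add: field_simps)
  have "pi / 2 \<le> quarter_period N"
    using quarter_period_strict_mono[of 0 N] N quarter_period_0 by (cases "N = 0") auto
  then have "1 / 2 \<le> quarter_period N / pi" by (simp add: field_simps)
  then have "3 / 2 \<le> ?E" using exp_ge_add_one_self[of "quarter_period N / pi"] by linarith
  then have "3 / 2 * ?q \<le> ?E * ?q" using q by simp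
  then have "?E * ?q \<le> 3" using upper by linarith
  then have "?q \<le> 3 / ?E" by (simp add: field_simps)
  then have "?q\<^sup>2 \<le> (3 / ?E)\<^sup>2" using q by (intro power_mono) auto
  also have "(3 / ?E)\<^sup>2 = 9 * exp (- 2 * quarter_period N / pi)"
    using exp_double[of "- (quarter_period N / pi)"]
    by (simp add: exp_minus divide_inverse power_mult_distrib mult.assoc)
  finally show ?thesis by (simp add: q)
qed

text \<open>While the wave \<open>u\<close> increases, the conservation law gives \<open>sqrt 2 u' \<ge> N\<^sup>2 - u\<^sup>2\<close>. With \<open>h\<close> the hyperbolic
tangent and \<open>0 \<le> u \<le> h\<close>, this yields \<open>sqrt 2 (h - u)' \<le> (1 - h\<^sup>2) - (N\<^sup>2 - u\<^sup>2) \<le> 1 - N\<^sup>2\<close>.\<close>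

lemma tanh_minus_wave_le:
  assumes N: "0 \<le> N" "N < 1" and t: "0 \<le> t" "t \<le> quarter_period N"
  shows "tanh (t / sqrt 2) - wave N t \<le> (1 - N\<^sup>2) * t / sqrt 2"
proof -
  let ?f = "\<lambda>t. tanh (t / sqrt 2) - wave N t - (1 - N\<^sup>2) * t / sqrt 2"
  have "?f t \<le> ?f 0"
  proof (rule DERIV_nonpos_imp_nonincreasing[OF t(1), where f = ?f])
    fix r assume r: "0 \<le> r" "r \<le> t"
    let ?h = "tanh (r / sqrt 2)" and ?u = "wave N r" and ?v = "wave_velocity N r"
    have "0 \<le> ?u"
      using wave_mono[OF N, of 0 r] wave_0[OF N] r t by simp
    then have "?u\<^sup>2 \<le> ?h\<^sup>2"
      using wave_le_tanh[OF N r(1)] by (intro power_mono)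
    have "0 \<le> ?v"
      unfolding wave_velocity_def using N r t phase_quarter_bounds[OF N, of r]
      by (intro mult_nonneg_nonneg cos_ge_zero less_imp_le[OF phase_speed_pos]) auto
    have "?u\<^sup>2 \<le> N\<^sup>2"
      using abs_wave_le[OF N, of r] by (metis abs_le_square_iff abs_of_nonneg N(1))
    have "(N\<^sup>2 - ?u\<^sup>2)\<^sup>2 \<le> (sqrt 2 * ?v)\<^sup>2"
    proof -
      have "(N\<^sup>2 - ?u\<^sup>2) * (N\<^sup>2 - ?u\<^sup>2) \<le> (N\<^sup>2 - ?u\<^sup>2) * (2 - N\<^sup>2 - ?u\<^sup>2)"
        using \<open>?u\<^sup>2 \<le> N\<^sup>2\<close> N_square_less_1[OF N] by (intro mult_left_mono) auto
      also have "\<dots> = (1 - ?u\<^sup>2)\<^sup>2 - (1 - N\<^sup>2)\<^sup>2" by (simp add: power2_eq_square algebra_simps)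
      also have "\<dots> = (sqrt 2 * ?v)\<^sup>2"
        using wave_velocity_square[OF N, of r] by (simp add: power_mult_distrib)
      finally show ?thesis by (simp add: power2_eq_square)
    qed
    then have "N\<^sup>2 - ?u\<^sup>2 \<le> sqrt 2 * ?v"
      by (rule power2_le_imp_le) (use \<open>0 \<le> ?v\<close> in simp)
    then have "(N\<^sup>2 - ?u\<^sup>2) / sqrt 2 \<le> ?v" by (simp add: field_simps)
    moreover have "(1 - ?h\<^sup>2) / sqrt 2 - (1 - N\<^sup>2) / sqrt 2 \<le> (N\<^sup>2 - ?u\<^sup>2) / sqrt 2"
      using \<open>?u\<^sup>2 \<le> ?h\<^sup>2\<close> unfolding diff_divide_distrib[symmetric]
      by (intro divide_right_mono) auto
    ultimately have "(1 - ?h\<^sup>2) / sqrt 2 - ?v - (1 - N\<^sup>2) / sqrt 2 \<le> 0" by linarith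
    moreover have "(?f has_real_derivative (1 - ?h\<^sup>2) / sqrt 2 - ?v - (1 - N\<^sup>2) / sqrt 2) (at r)"
      by (auto intro!: derivative_eq_intros wave_has_derivative[OF N] simp: field_simps)
    ultimately show "\<exists>y. (?f has_real_derivative y) (at r) \<and> y \<le> 0" by blast
  qed
  then show ?thesis by (simp add: wave_0[OF N])
qed

text \<open>The factor \<open>t \<le> \<pi> / (2 \<kappa>)\<close> in \<open>tanh_minus_wave_le\<close> is absorbed by giving up half of the exponential rate:
\<open>y / 2 \<le> exp (y / 2)\<close> for \<open>y = 1 / \<kappa>\<close>.\<close>

lemma scaled_wave_tanh_close:
  assumes "0 < \<kappa>" and N: "0 \<le> N" "N < 1" "quarter_period N = pi / (2 * \<kappa>)"
    and x: "0 \<le> x" "x \<le> pi / 2"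
  shows "\<bar>wave N (x / \<kappa>) - tanh (x / (sqrt 2 * \<kappa>))\<bar> \<le> 36 * exp (- (1 / 2) / \<kappa>)"
proof -
  define t where "t = x / \<kappa>"
  have t: "0 \<le> t" "t \<le> quarter_period N"
    using assms by (auto simp: t_def field_simps)
  have "tanh (t / sqrt 2) - wave N t \<le> (1 - N\<^sup>2) * t / sqrt 2"
    by (rule tanh_minus_wave_le[OF N(1,2) t])
  also have "\<dots> \<le> (1 - N\<^sup>2) * t / 1"
    using t N_square_less_1[OF N(1,2)] by (intro divide_left_mono) auto
  also have "\<dots> \<le> (9 * exp (- 1 / \<kappa>)) * (2 / \<kappa>)"
  proof -
    have "t \<le> 2 / \<kappa>"
      using t pi_less_4 \<open>0 < \<kappa>\<close> unfolding N by (auto intro: order_trans simp: field_simps)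
    then show ?thesis
      using amplitude_deficit_exponentially_small[OF N(1,2)] t(1) N(3)
      by (simp only: div_by_1, intro mult_mono) auto
  qed
  also have "\<dots> \<le> 36 * exp (- (1 / 2) / \<kappa>)"
  proof -
    have "1 / 2 / \<kappa> \<le> exp (1 / 2 / \<kappa>)"
      using exp_ge_add_one_self[of "1 / 2 / \<kappa>"] by linarith
    then have "exp (- 1 / \<kappa>) * (1 / 2 / \<kappa>) \<le> exp (- 1 / \<kappa>) * exp (1 / 2 / \<kappa>)"
      by (intro mult_left_mono) auto
    also have "\<dots> = exp (- (1 / 2) / \<kappa>)"
      using \<open>0 < \<kappa>\<close> by (simp add: exp_add[symmetric] field_simps)
    finally have "36 * (exp (- 1 / \<kappa>) * (1 / 2 / \<kappa>)) \<le> 36 * exp (- (1 / 2) / \<kappa>)" by simp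
    also have "36 * (exp (- 1 / \<kappa>) * (1 / 2 / \<kappa>)) = (9 * exp (- 1 / \<kappa>)) * (2 / \<kappa>)" by simp
    finally show ?thesis .
  qed
  finally show ?thesis
    using wave_le_tanh[OF N(1,2) t(1)] by (simp add: t_def mult.commute)
qed

lemma abs_fourth_power_diff_le:
  fixes a b :: real
  assumes "\<bar>a\<bar> \<le> 1" "\<bar>b\<bar> \<le> 1"
  shows "\<bar>a ^ 4 - b ^ 4\<bar> \<le> 4 * \<bar>a - b\<bar>"
proof -
  have "a\<^sup>2 \<le> 1" "b\<^sup>2 \<le> 1" using assms by (auto simp: abs_square_le_1)
  then have "\<bar>a + b\<bar> * \<bar>a\<^sup>2 + b\<^sup>2\<bar> \<le> 2 * 2"
    using assms by (intro mult_mono) auto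
  then have "\<bar>a - b\<bar> * (\<bar>a + b\<bar> * \<bar>a\<^sup>2 + b\<^sup>2\<bar>) \<le> \<bar>a - b\<bar> * (2 * 2)"
    by (rule mult_left_mono) simp
  moreover have "a ^ 4 - b ^ 4 = (a - b) * ((a + b) * (a\<^sup>2 + b\<^sup>2))"
    by (simp add: power2_eq_square power4_eq_xxxx algebra_simps)
  ultimately show ?thesis by (simp add: abs_mult)
qed

text \<open>For the profile \<open>p(x) = tanh (x / (sqrt 2 \<kappa>))\<close> the integrand is \<open>1 - p\<^sup>4 = sqrt 2 \<kappa> (1 + p\<^sup>2) p'\<close>, with primitive
\<open>sqrt 2 \<kappa> (p + p\<^sup>3 / 3)\<close>. The mean value theorem bounds the error by the length \<open>\<pi> / 2 \<le> 2\<close> times the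
largest difference of fourth powers, which is at most \<open>4 \<cdot> 36 exp (-1 / (2 \<kappa>))\<close>.\<close>

lemma scaled_wave_energy_close:
  assumes "0 < \<kappa>" and N: "0 \<le> N" "N < 1" "quarter_period N = pi / (2 * \<kappa>)"
  defines "h \<equiv> tanh (pi / 2 / (sqrt 2 * \<kappa>))"
  shows "\<bar>energy \<kappa> (\<lambda>x. wave N (x / \<kappa>)) - \<kappa> * sqrt 2 * (h + h ^ 3 / 3)\<bar> \<le> 288 * exp (- (1 / 2) / \<kappa>)"
proof -
  define p where "p x = tanh (x / (sqrt 2 * \<kappa>))" for x
  let ?U = "\<lambda>x. wave N (x / \<kappa>)"
  obtain F where F: "\<And>x. (F has_real_derivative 1 - (?U x) ^ 4) (at x)"
    using quartic_primitive[OF scaled_wave_solution[OF assms(1) N]] by blast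
  define H where "H x = \<kappa> * sqrt 2 * (p x + (p x) ^ 3 / 3)" for x
  have p: "(p has_real_derivative (1 - (p x)\<^sup>2) / (sqrt 2 * \<kappa>)) (at x)" for x
    unfolding p_def[abs_def] using \<open>0 < \<kappa>\<close> by (auto intro!: derivative_eq_intros)
  have H: "(H has_real_derivative 1 - (p x) ^ 4) (at x)" for x
  proof -
    have "(H has_real_derivative \<kappa> * sqrt 2 *
        ((1 - (p x)\<^sup>2) / (sqrt 2 * \<kappa>) + 3 * (p x)\<^sup>2 * ((1 - (p x)\<^sup>2) / (sqrt 2 * \<kappa>)) / 3)) (at x)"
      unfolding H_def[abs_def] by (auto intro!: derivative_eq_intros p simp: power2_eq_square)
    also have "\<kappa> * sqrt 2 *
        ((1 - (p x)\<^sup>2) / (sqrt 2 * \<kappa>) + 3 * (p x)\<^sup>2 * ((1 - (p x)\<^sup>2) / (sqrt 2 * \<kappa>)) / 3) = 1 - (p x) ^ 4"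
      using \<open>0 < \<kappa>\<close> by (simp add: field_simps power2_eq_square power4_eq_xxxx)
    finally show ?thesis .
  qed
  obtain z where z: "0 < z" "z < pi / 2"
    "(F (pi / 2) - H (pi / 2)) - (F 0 - H 0) = (pi / 2 - 0) * ((1 - (?U z) ^ 4) - (1 - (p z) ^ 4))"
    using MVT2[of 0 "pi / 2" "\<lambda>x. F x - H x" "\<lambda>x. (1 - (?U x) ^ 4) - (1 - (p x) ^ 4)"] DERIV_diff[OF F H]
    by (auto simp: mult.commute)
  have close: "\<bar>?U z - p z\<bar> \<le> 36 * exp (- (1 / 2) / \<kappa>)"
    unfolding p_def using scaled_wave_tanh_close[OF assms(1) N] z by simp
  have U1: "\<bar>?U z\<bar> \<le> 1" using abs_wave_le[OF N(1,2), of "z / \<kappa>"] N by linarith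
  have p1: "\<bar>p z\<bar> \<le> 1" unfolding p_def using tanh_real_bounds[of "z / (sqrt 2 * \<kappa>)"] by auto
  have "\<bar>(p z) ^ 4 - (?U z) ^ 4\<bar> \<le> 4 * (36 * exp (- (1 / 2) / \<kappa>))"
    using abs_fourth_power_diff_le[OF p1 U1] close
    by (simp add: abs_minus_commute[of "p z" "?U z"])
  then have "\<bar>(F (pi / 2) - H (pi / 2)) - (F 0 - H 0)\<bar> \<le> 2 * (4 * (36 * exp (- (1 / 2) / \<kappa>)))"
    unfolding z abs_mult using pi_less_4 by (intro mult_mono) auto
  moreover have "H 0 = 0" "H (pi / 2) = \<kappa> * sqrt 2 * (h + h ^ 3 / 3)"
    by (simp_all add: H_def p_def h_def)
  ultimately show ?thesis
    using energy_scaled_wave[OF assms(1) N F] by (simp add: algebra_simps)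
qed

text \<open>As \<open>\<kappa>\<close> tends to 0 the hyperbolic tangent tends to 1, so the main term tends to
\<open>sqrt 2 (1 + 1/3)\<close>, and the exponential beats the division by \<open>\<kappa>\<close>.\<close>

lemma scaled_energy_limit:
  fixes e :: "real \<Rightarrow> real"
  assumes close: "\<And>\<kappa>. 0 < \<kappa> \<Longrightarrow> \<kappa> < 1 \<Longrightarrow> \<bar>e \<kappa> - \<kappa> * sqrt 2 * (tanh (pi / 2 / (sqrt 2 * \<kappa>)) +
      (tanh (pi / 2 / (sqrt 2 * \<kappa>))) ^ 3 / 3)\<bar> \<le> 288 * exp (- (1 / 2) / \<kappa>)"
  shows "((\<lambda>\<kappa>. e \<kappa> / \<kappa>) \<longlongrightarrow> 4 / 3 * sqrt 2) (at_right 0)"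
proof -
  define h where "h \<kappa> = tanh (pi / 2 / (sqrt 2 * \<kappa>))" for \<kappa>
  have "filterlim (\<lambda>\<kappa>. pi / 2 / (sqrt 2 * \<kappa>)) at_top (at_right 0)"
    by real_asymp
  then have "(h \<longlongrightarrow> 1) (at_right 0)"
    unfolding h_def[abs_def] by (rule filterlim_compose[OF tanh_real_at_top])
  then have "((\<lambda>\<kappa>. sqrt 2 * (h \<kappa> + (h \<kappa>) ^ 3 / 3)) \<longlongrightarrow> sqrt 2 * (1 + 1 ^ 3 / 3)) (at_right 0)"
    by (intro tendsto_intros) simp_all
  moreover have "((\<lambda>\<kappa>. e \<kappa> / \<kappa> - sqrt 2 * (h \<kappa> + (h \<kappa>) ^ 3 / 3)) \<longlongrightarrow> 0) (at_right 0)"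
  proof (rule Lim_null_comparison)
    show "((\<lambda>\<kappa>::real. 288 * exp (- (1 / 2) / \<kappa>) / \<kappa>) \<longlongrightarrow> 0) (at_right 0)"
      by real_asymp
    have "\<forall>\<^sub>F \<kappa> in at_right 0. 0 < \<kappa> \<and> \<kappa> < (1::real)"
      using eventually_at_right_real[of 0 1] by (auto elim: eventually_mono)
    then show "\<forall>\<^sub>F \<kappa> in at_right 0. norm (e \<kappa> / \<kappa> - sqrt 2 * (h \<kappa> + (h \<kappa>) ^ 3 / 3))
        \<le> 288 * exp (- (1 / 2) / \<kappa>) / \<kappa>"
    proof eventually_elim
      case (elim \<kappa>)
      have "e \<kappa> / \<kappa> - sqrt 2 * (h \<kappa> + (h \<kappa>) ^ 3 / 3)
          = (e \<kappa> - \<kappa> * sqrt 2 * (h \<kappa> + (h \<kappa>) ^ 3 / 3)) / \<kappa>"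
        using elim by (simp add: diff_divide_distrib)
      then show ?case
        using close[of \<kappa>] elim unfolding h_def
        by (simp only: real_norm_def abs_divide) (auto intro!: divide_right_mono)
    qed
  qed
  ultimately have "((\<lambda>\<kappa>. sqrt 2 * (h \<kappa> + (h \<kappa>) ^ 3 / 3)
      + (e \<kappa> / \<kappa> - sqrt 2 * (h \<kappa> + (h \<kappa>) ^ 3 / 3))) \<longlongrightarrow> sqrt 2 * (1 + 1 ^ 3 / 3) + 0) (at_right 0)"
    by (rule tendsto_add)
  then show ?thesis by (simp add: mult.commute)
qed

section \<open>The minimal energy\<close>

text \<open>The classification with its wave recognised as a ground state: the strict bound \<open>j \<kappa> < 1\<close> comes from
quarter periods of positive amplitude exceeding \<open>\<pi> / 2\<close>. In particular \<open>\<kappa> \<ge> 1\<close> leaves no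
nonconstant solution.\<close>

lemma nonconstant_periodic_solution:
  assumes "0 < \<kappa>" and sol: "allen_cahn_solution \<kappa> u" and per: "periodic_2pi u"
    and nonconst: "u \<noteq> (\<lambda>x. 1)" "u \<noteq> (\<lambda>x. - 1)" "u \<noteq> (\<lambda>x. 0)"
  obtains j b where "1 \<le> (j::nat)" "of_nat j * \<kappa> < 1"
    "u = (\<lambda>x. ground_state (of_nat j * \<kappa>) (of_nat j * (x + b)))"
    "energy \<kappa> u = energy (of_nat j * \<kappa>) (ground_state (of_nat j * \<kappa>))"
proof -
  obtain N j b where N: "0 < N" "N < 1" and j: "1 \<le> (j::nat)"
    and T: "quarter_period N = pi / (2 * (of_nat j * \<kappa>))" and u: "u = (\<lambda>x. wave N ((x + b) / \<kappa>))"
    using periodic_solution_classification[OF assms] by blast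
  let ?\<mu> = "of_nat j * \<kappa>"
  have \<mu>: "0 < ?\<mu>" using j \<open>0 < \<kappa>\<close> by simp
  have "pi / 2 < pi / (2 * ?\<mu>)"
    using quarter_period_strict_mono[of 0 N] N by (simp add: quarter_period_0 T)
  then have "?\<mu> < 1" using \<mu> by (simp add: field_simps)
  then have gs: "ground_state ?\<mu> = (\<lambda>x. wave N (x / ?\<mu>))"
    using ground_state_eq[OF \<mu>] ground_state_max_eqI[OF N T] by simp
  then have u_gs: "u = (\<lambda>x. ground_state ?\<mu> (of_nat j * (x + b)))"
    using j u by simp
  have "energy (?\<mu> / of_nat j) (\<lambda>x. ground_state ?\<mu> (of_nat j * x + of_nat j * b))
      = energy ?\<mu> (ground_state ?\<mu>)"
    unfolding gs using \<mu> j N T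
    by (intro energy_rescaled scaled_wave_solution scaled_wave_periodic) auto
  then have "energy \<kappa> u = energy ?\<mu> (ground_state ?\<mu>)"
    using j by (simp add: u_gs distrib_left)
  then show ?thesis using that[OF j \<open>?\<mu> < 1\<close> u_gs] by blast
qed

lemma solutions_cases:
  assumes "0 < \<kappa>" "u \<in> solutions \<kappa>"
  obtains "u = (\<lambda>x. 0)"
  | j where "1 \<le> (j::nat)" "of_nat j * \<kappa> < 1"
    "energy \<kappa> u = energy (of_nat j * \<kappa>) (ground_state (of_nat j * \<kappa>))"
proof (cases "u = (\<lambda>x. 0)")
  case False
  have u: "allen_cahn_solution \<kappa> u" "periodic_2pi u" "\<And>x. \<bar>u x\<bar> < 1"
    using assms by (auto simp: solutions_def)
  then have "u \<noteq> (\<lambda>x. 1)" "u \<noteq> (\<lambda>x. - 1)"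
    by (metis abs_one abs_minus_cancel less_irrefl)+
  then show ?thesis
    using nonconstant_periodic_solution[OF assms(1) u(1,2) _ _ False] that(2) by blast
qed (use that in blast)

lemma zero_in_solutions:
  assumes "\<kappa> \<noteq> 0"
  shows "(\<lambda>x. 0) \<in> solutions \<kappa>"
  using assms by (intro solution_in_solutions allen_cahn_solution_const) (auto simp: periodic_2pi_def)

lemma ground_state_in_solutions:
  assumes "0 < \<kappa>" "\<kappa> < 1"
  shows "ground_state \<kappa> \<in> solutions \<kappa>"
proof -
  note N = ground_state_max[OF assms]
  have "\<bar>wave (ground_state_max \<kappa>) (x / \<kappa>)\<bar> < 1" for x
    using abs_wave_le[of "ground_state_max \<kappa>" "x / \<kappa>"] N by simp
  then show ?thesis
    unfolding ground_state_eq[OF assms] using assms N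
    by (intro solution_in_solutions scaled_wave_solution scaled_wave_periodic) auto
qed

lemma ground_state_energy_strict_mono:
  assumes "0 < \<kappa>" "\<kappa> < \<mu>" "\<mu> < 1"
  shows "energy \<kappa> (ground_state \<kappa>) < energy \<mu> (ground_state \<mu>)"
proof -
  have "\<kappa> < 1" "0 < \<mu>" using assms by auto
  then show ?thesis
    unfolding ground_state_eq[OF assms(1) \<open>\<kappa> < 1\<close>] ground_state_eq[OF \<open>0 < \<mu>\<close> assms(3)]
    using ground_state_max[OF assms(1) \<open>\<kappa> < 1\<close>] ground_state_max[OF \<open>0 < \<mu>\<close> assms(3)] assms
    by (intro energy_scaled_wave_strict_mono) auto
qed

text \<open>Zero is the wave of amplitude 0, whose quarter period \<open>\<pi> / 2\<close> belongs to \<open>\<kappa> = 1\<close>, so this is an instance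
of the strict monotonicity of the energy.\<close>

lemma ground_state_energy_less:
  assumes "0 < \<kappa>" "\<kappa> < 1"
  shows "energy \<kappa> (ground_state \<kappa>) < pi / 2"
proof -
  have "energy \<kappa> (\<lambda>x. wave (ground_state_max \<kappa>) (x / \<kappa>)) < energy 1 (\<lambda>x. wave 0 (x / 1))"
    using ground_state_max[OF assms] assms
    by (intro energy_scaled_wave_strict_mono) (auto simp: quarter_period_0)
  then show ?thesis
    by (simp add: ground_state_eq[OF assms] wave_def energy_zero)
qed

lemma min_energy_eqI:
  assumes "u \<in> solutions \<kappa>" "\<And>w. w \<in> solutions \<kappa> \<Longrightarrow> energy \<kappa> u \<le> energy \<kappa> w"
  shows "min_energy \<kappa> = energy \<kappa> u"
  unfolding min_energy_def using assms by (intro cInf_eq_minimum) auto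

lemma min_energy_eq_ground_state:
  assumes "0 < \<kappa>" "\<kappa> < 1"
  shows "min_energy \<kappa> = energy \<kappa> (ground_state \<kappa>)"
proof (rule min_energy_eqI[OF ground_state_in_solutions[OF assms]])
  fix w assume "w \<in> solutions \<kappa>"
  with assms(1) show "energy \<kappa> (ground_state \<kappa>) \<le> energy \<kappa> w"
  proof (cases rule: solutions_cases)
    case 1
    then show ?thesis
      using ground_state_energy_less[OF assms] energy_zero[of \<kappa>] assms by simp
  next
    case (2 j)
    show ?thesis
    proof (cases "j = 1")
      case False
      then have "\<kappa> < of_nat j * \<kappa>" using \<open>1 \<le> j\<close> assms by simp
      then show ?thesis
        using ground_state_energy_strict_mono[OF assms(1) _ 2(2)] 2(3) by simp
    qed (use 2 in simp)
  qed
qed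

lemma solutions_trivial:
  assumes "1 \<le> \<kappa>"
  shows "solutions \<kappa> = {\<lambda>x. 0}"
proof -
  have "u = (\<lambda>x. 0)" if "u \<in> solutions \<kappa>" for u
  proof (rule solutions_cases[OF _ that])
    fix j assume "1 \<le> (j::nat)" "of_nat j * \<kappa> < 1"
    moreover have "1 * 1 \<le> of_nat j * \<kappa>" using assms \<open>1 \<le> j\<close> by (intro mult_mono) auto
    ultimately show ?thesis by simp
  qed (use assms in auto)
  moreover have "(\<lambda>x. 0) \<in> solutions \<kappa>" using assms by (intro zero_in_solutions) simp
  ultimately show ?thesis by blast
qed

lemma min_energy_trivial:
  assumes "1 \<le> \<kappa>"
  shows "min_energy \<kappa> = pi / 2"
  using assms energy_zero[of \<kappa>] by (simp add: min_energy_def solutions_trivial)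

theorem theorem1p2:
  "(\<forall>\<kappa>>0. \<exists>u\<in>solutions \<kappa>. energy \<kappa> u = min_energy \<kappa>) \<and>
   (\<forall>\<kappa>\<ge>1. min_energy \<kappa> = pi / 2 \<and>
      (\<forall>u. (u \<in> solutions \<kappa> \<and> energy \<kappa> u = min_energy \<kappa>) \<longleftrightarrow> u = (\<lambda>x. 0))) \<and>
   (\<forall>\<kappa>. 0 < \<kappa> \<and> \<kappa> < 1 \<longrightarrow>
      ground_state \<kappa> \<in> solutions \<kappa> \<and> energy \<kappa> (ground_state \<kappa>) = min_energy \<kappa>) \<and>
   (\<forall>\<kappa>\<^sub>1 \<kappa>\<^sub>2. 0 < \<kappa>\<^sub>1 \<and> \<kappa>\<^sub>1 < \<kappa>\<^sub>2 \<and> \<kappa>\<^sub>2 \<le> 1 \<longrightarrow> min_energy \<kappa>\<^sub>1 < min_energy \<kappa>\<^sub>2) \<and>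
   (\<exists>C>0. \<exists>d>0. \<forall>\<kappa>. 0 < \<kappa> \<and> \<kappa> < 1 \<longrightarrow>
      (\<forall>x. 0 \<le> x \<and> x \<le> pi / 2 \<longrightarrow>
         \<bar>ground_state \<kappa> x - tanh (x / (sqrt 2 * \<kappa>))\<bar> \<le> C * exp (- d / \<kappa>))) \<and>
   ((\<lambda>\<kappa>. min_energy \<kappa> / \<kappa>) \<longlongrightarrow> 4 / 3 * sqrt 2) (at_right 0) \<and> 4 / 3 * sqrt 2 > (0::real) \<and>
   (\<forall>\<kappa> u. 0 < \<kappa> \<and> \<kappa> < 1 \<and> periodic_2pi u \<and> allen_cahn_solution \<kappa> u \<and>
      u \<noteq> (\<lambda>x. 1) \<and> u \<noteq> (\<lambda>x. - 1) \<and> u \<noteq> (\<lambda>x. 0) \<longrightarrow>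
      (\<exists>j::nat. 1 \<le> j \<and> real j < 1 / \<kappa> \<and>
         coincide_up_to_shift_reflection u (rescaled_ground_state \<kappa> j) \<and>
         energy \<kappa> u = energy (real j * \<kappa>) (ground_state (real j * \<kappa>))))"
proof (intro conjI)
  show a: "\<forall>\<kappa>\<ge>1. min_energy \<kappa> = pi / 2 \<and>
      (\<forall>u. (u \<in> solutions \<kappa> \<and> energy \<kappa> u = min_energy \<kappa>) \<longleftrightarrow> u = (\<lambda>x. 0))"
  proof (intro allI impI)
    fix \<kappa> :: real assume \<kappa>: "1 \<le> \<kappa>"
    have "energy \<kappa> (\<lambda>x. 0) = pi / 2" using \<kappa> by (intro energy_zero) simp
    then show "min_energy \<kappa> = pi / 2 \<and>
        (\<forall>u. (u \<in> solutions \<kappa> \<and> energy \<kappa> u = min_energy \<kappa>) \<longleftrightarrow> u = (\<lambda>x. 0))"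
      unfolding min_energy_trivial[OF \<kappa>] solutions_trivial[OF \<kappa>] by blast
  qed
  show b: "\<forall>\<kappa>. 0 < \<kappa> \<and> \<kappa> < 1 \<longrightarrow>
      ground_state \<kappa> \<in> solutions \<kappa> \<and> energy \<kappa> (ground_state \<kappa>) = min_energy \<kappa>"
    using ground_state_in_solutions min_energy_eq_ground_state by simp
  show "\<forall>\<kappa>>0. \<exists>u\<in>solutions \<kappa>. energy \<kappa> u = min_energy \<kappa>"
    using a b by (metis not_less)
  show "\<forall>\<kappa>\<^sub>1 \<kappa>\<^sub>2. 0 < \<kappa>\<^sub>1 \<and> \<kappa>\<^sub>1 < \<kappa>\<^sub>2 \<and> \<kappa>\<^sub>2 \<le> 1 \<longrightarrow> min_energy \<kappa>\<^sub>1 < min_energy \<kappa>\<^sub>2"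
  proof (intro allI impI, elim conjE)
    fix \<kappa>\<^sub>1 \<kappa>\<^sub>2 :: real assume "0 < \<kappa>\<^sub>1" "\<kappa>\<^sub>1 < \<kappa>\<^sub>2" "\<kappa>\<^sub>2 \<le> 1"
    then show "min_energy \<kappa>\<^sub>1 < min_energy \<kappa>\<^sub>2"
      using ground_state_energy_less[of \<kappa>\<^sub>1] ground_state_energy_strict_mono[of \<kappa>\<^sub>1 \<kappa>\<^sub>2]
        min_energy_eq_ground_state[of \<kappa>\<^sub>1] min_energy_eq_ground_state[of \<kappa>\<^sub>2] min_energy_trivial[of \<kappa>\<^sub>2]
      by linarith
  qed
  show "\<exists>C>0. \<exists>d>0. \<forall>\<kappa>. 0 < \<kappa> \<and> \<kappa> < 1 \<longrightarrow>
      (\<forall>x. 0 \<le> x \<and> x \<le> pi / 2 \<longrightarrow>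
         \<bar>ground_state \<kappa> x - tanh (x / (sqrt 2 * \<kappa>))\<bar> \<le> C * exp (- d / \<kappa>))"
  proof (rule exI[of _ 36], intro conjI exI[of _ "1 / 2"] allI impI; (elim conjE)?)
    fix \<kappa> x :: real assume "0 < \<kappa>" "\<kappa> < 1" "0 \<le> x" "x \<le> pi / 2"
    then show "\<bar>ground_state \<kappa> x - tanh (x / (sqrt 2 * \<kappa>))\<bar> \<le> 36 * exp (- (1 / 2) / \<kappa>)"
      unfolding ground_state_eq[OF \<open>0 < \<kappa>\<close> \<open>\<kappa> < 1\<close>] using ground_state_max[of \<kappa>]
      by (intro scaled_wave_tanh_close) auto
  qed auto
  show "((\<lambda>\<kappa>. min_energy \<kappa> / \<kappa>) \<longlongrightarrow> 4 / 3 * sqrt 2) (at_right 0)"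
  proof (rule scaled_energy_limit)
    fix \<kappa> :: real assume \<kappa>: "0 < \<kappa>" "\<kappa> < 1"
    show "\<bar>min_energy \<kappa> - \<kappa> * sqrt 2 * (tanh (pi / 2 / (sqrt 2 * \<kappa>)) +
        (tanh (pi / 2 / (sqrt 2 * \<kappa>))) ^ 3 / 3)\<bar> \<le> 288 * exp (- (1 / 2) / \<kappa>)"
      unfolding min_energy_eq_ground_state[OF \<kappa>] ground_state_eq[OF \<kappa>]
      using ground_state_max[OF \<kappa>] \<kappa> by (intro scaled_wave_energy_close) auto
  qed
  show "4 / 3 * sqrt 2 > (0::real)" by simp
  show "\<forall>\<kappa> u. 0 < \<kappa> \<and> \<kappa> < 1 \<and> periodic_2pi u \<and> allen_cahn_solution \<kappa> u \<and>
      u \<noteq> (\<lambda>x. 1) \<and> u \<noteq> (\<lambda>x. - 1) \<and> u \<noteq> (\<lambda>x. 0) \<longrightarrow>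
      (\<exists>j::nat. 1 \<le> j \<and> real j < 1 / \<kappa> \<and>
         coincide_up_to_shift_reflection u (rescaled_ground_state \<kappa> j) \<and>
         energy \<kappa> u = energy (real j * \<kappa>) (ground_state (real j * \<kappa>)))"
  proof (intro allI impI, elim conjE)
    fix \<kappa> :: real and u :: "real \<Rightarrow> real"
    assume "0 < \<kappa>" "\<kappa> < 1" "periodic_2pi u" "allen_cahn_solution \<kappa> u"
      "u \<noteq> (\<lambda>x. 1)" "u \<noteq> (\<lambda>x. - 1)" "u \<noteq> (\<lambda>x. 0)"
    then obtain j b where j: "1 \<le> (j::nat)" "of_nat j * \<kappa> < 1"
      "u = (\<lambda>x. ground_state (of_nat j * \<kappa>) (of_nat j * (x + b)))"
      "energy \<kappa> u = energy (of_nat j * \<kappa>) (ground_state (of_nat j * \<kappa>))"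
      using nonconstant_periodic_solution by metis
    have "coincide_up_to_shift_reflection u (rescaled_ground_state \<kappa> j)"
      unfolding coincide_up_to_shift_reflection_def rescaled_ground_state_def j(3)
      by (intro exI[of _ "- b"] bexI[of _ 1]) auto
    moreover have "real j < 1 / \<kappa>" using j(2) \<open>0 < \<kappa>\<close> by (simp add: field_simps)
    ultimately show "\<exists>j::nat. 1 \<le> j \<and> real j < 1 / \<kappa> \<and>
         coincide_up_to_shift_reflection u (rescaled_ground_state \<kappa> j) \<and>
         energy \<kappa> u = energy (real j * \<kappa>) (ground_state (real j * \<kappa>))"
      using j by blast
  qed
qed

end
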